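(* Consider the SEA model (see context) on $\mathcal{X}\subseteq\mathbb{R}^d$ with horizon $T$. Assume there are constants $G,D,L>0$ such that: (i) $\max_{\mathbf{x}\in\mathcal{X}}\|\nabla f_t(\mathbf{x})\|_2\le G$ for every individual function $f_t$, $t\in[T]$; (ii) $\mathbf{0}\in\mathcal{X}$ and $\|\mathbf{x}-\mathbf{y}\|_2\le D$ for all $\mathbf{x},\mathbf{y}\in\mathcal{X}$; (iii) every expected function $F_t$, $t\in[T]$, is $L$-smooth on $\mathcal{X}$, i.e. $\|\nabla F_t(\mathbf{x})-\nabla F_t(\mathbf{y})\|_2\le L\|\mathbf{x}-\mathbf{y}\|_2$ for all $\mathbf x,\mathbf y\in\mathcal X$; (iv) every expected function $F_t$, $t\in[T]$, is convex on $\mathcal{X}$ (the individual functions $f_t$ need not be convex). Let $\Pi_{\mathcal{X}}$ be the Euclidean projection onto $\mathcal{X}$, let $\mathbf{x}_1=\hat{\mathbf{x}}_1$ be any point of $\mathcal{X}$, and run optimistic online mirror descent $$\hat{\mathbf{x}}_{t+1}=\Pi_{\mathcal{X}}\big[\hat{\mathbf{x}}_t-\eta_t\nabla f_t(\mathbf{x}_t)\big],\qquad \mathbf{x}_{t+1}=\Pi_{\mathcal{X}}\big[\hat{\mathbf{x}}_{t+1}-\eta_{t+1}\nabla f_t(\mathbf{x}_t)\big],$$ with step sizes $\eta_t=D/\sqrt{\delta+4G^2+\bar V_{t-1}}$, where $\bar V_{t-1}=\sum_{s=1}^{t-1}\|\nabla f_s(\mathbf{x}_s)-\nabla f_{s-1}(\mathbf{x}_{s-1})\|_2^2$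 (with $\nabla f_0(\mathbf{x}_0)=\mathbf 0$) and $\delta=10D^2L^2$. Then for every fixed $\mathbf{u}\in\mathcal{X}$, $$\mathbb{E}\Big[\sum_{t=1}^T f_t(\mathbf{x}_t)-\sum_{t=1}^T f_t(\mathbf{u})\Big]\le 5\sqrt{10}\,D^2L+\frac{5\sqrt5\,DG}{2}+5\sqrt2\,D\sqrt{\sigma_{1:T}^2}+5D\sqrt{\Sigma_{1:T}^2}.$$ In particular the expected regret is $\mathcal{O}\big(\sqrt{\sigma_{1:T}^2}+\sqrt{\Sigma_{1:T}^2}\big)$.
   Context: SEA (Stochastically Extended Adversarial) model: $d,T\ge1$, $[T]=\{1,\dots,T\}$, and $\mathcal{X}\subseteq\mathbb{R}^d$ is a nonempty closed convex feasible domain. In each round $t\in[T]$ the learner selects $\mathbf{x}_t\in\mathcal{X}$ based on the previously observed functions $f_1,\dots,f_{t-1}$; nature chooses a distribution $\mathfrak{D}_t$ over differentiable functions $\mathcal{X}\to\mathbb{R}$ (possibly random, depending on the past); then the individual (random) function $f_t$ is sampled from $\mathfrak{D}_t$ (i.e. conditionally on the past and on $\mathfrak{D}_t$, $f_t$ has law $\mathfrak{D}_t$), the learner suffers $f_t(\mathbf{x}_t)$ and observes $f_t$. The (conditional) expected function is $F_t(\mathbf{x})=\mathbb{E}_{f_t\sim\mathfrak{D}_t}[f_t(\mathbf{x})]$, and differentiation and expectation may be interchanged: $\nabla F_t(\mathbf{x})=\mathbb{E}_{f_t\sim\mathfrak{D}_t}[\nabla f_t(\mathbf{x})]$. Define $$\sigma_t^2=\sup_{\mathbf{x}\in\mathcal{X}}\mathbb{E}_{f_t\sim\mathfrak{D}_t}\big[\|\nabla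 f_t(\mathbf{x})-\nabla F_t(\mathbf{x})\|_2^2\big],\quad \sigma_{1:T}^2=\mathbb{E}\Big[\sum_{t=1}^T\sigma_t^2\Big],\quad \Sigma_{1:T}^2=\mathbb{E}\Big[\sum_{t=1}^T\sup_{\mathbf{x}\in\mathcal{X}}\|\nabla F_t(\mathbf{x})-\nabla F_{t-1}(\mathbf{x})\|_2^2\Big],$$ with $\nabla F_0\equiv\mathbf 0$. The $\mathcal{O}$-notation means: bounded by $C\,(1+\sqrt{\sigma_{1:T}^2}+\sqrt{\Sigma_{1:T}^2})$ with $C$ depending only on $D,G,L$. *)

theory Defs
  imports "HOL-Probability.Probability"
begin

text \<open>
  The distributions of the model live on a measurable space whose points are functions
  \<open>real ^ 'n \<Rightarrow> real\<close>; only their values on the feasible domain \<open>X\<close> are ever used. The gradient of such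
  a function is supplied by an operator \<open>nabla\<close>. On a domain with nonempty interior the derivative
  within \<open>X\<close> determines it; on a lower-dimensional domain it is an arbitrary vector field
  representing the derivative within \<open>X\<close>, so that, for instance, the restriction of the full gradient
  of a function differentiable near \<open>X\<close> is admissible.
\<close>

definition has_gradient_within ::
  "(real ^ 'n \<Rightarrow> real) \<Rightarrow> real ^ 'n \<Rightarrow> (real ^ 'n) set \<Rightarrow> real ^ 'n \<Rightarrow> bool" where
  "has_gradient_within \<phi> v X x \<longleftrightarrow> (\<phi> has_derivative (\<lambda>h. v \<bullet> h)) (at x within X)"

definition expected_function ::
  "(real ^ 'n \<Rightarrow> real) measure \<Rightarrow> real ^ 'n \<Rightarrow> real" where
  "expected_function \<mu> x = (\<integral>\<phi>. \<phi> x \<partial>\<mu>)"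

definition expected_gradient ::
  "((real ^ 'n \<Rightarrow> real) \<Rightarrow> real ^ 'n \<Rightarrow> real ^ 'n) \<Rightarrow> (real ^ 'n \<Rightarrow> real) measure
    \<Rightarrow> real ^ 'n \<Rightarrow> real ^ 'n" where
  "expected_gradient nabla \<mu> x = (\<integral>\<phi>. nabla \<phi> x \<partial>\<mu>)"

definition gradient_variance ::
  "(real ^ 'n) set \<Rightarrow> ((real ^ 'n \<Rightarrow> real) \<Rightarrow> real ^ 'n \<Rightarrow> real ^ 'n)
    \<Rightarrow> (real ^ 'n \<Rightarrow> real) measure \<Rightarrow> real" where
  "gradient_variance X nabla \<mu> =
     (SUP x\<in>X. \<integral>\<phi>. (norm (nabla \<phi> x - expected_gradient nabla \<mu> x))\<^sup>2 \<partial>\<mu>)"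

text \<open>
  \<open>H t\<close> is the information available just before the \<open>t\<close>-th function is drawn: it contains the
  functions \<open>f s\<close> with \<open>1 \<le> s < t\<close> and the distributions \<open>P s\<close> with \<open>1 \<le> s \<le> t\<close>, and possibly further
  randomness used by nature. The condition \<open>conditional_law\<close> says that, given \<open>H t\<close>, the function
  \<open>f t\<close> has law \<open>P t\<close>. The condition \<open>differentiate_expectation\<close> is the interchange of gradient and
  expectation. Measurability of the variance does not follow from the other conditions
  (it is a supremum over an uncountable set of functions that need not be continuous), but it is
  needed for its expectation to make sense.
\<close>

locale sea_model = prob_space M + filtration "space M" H
  for M :: "'w measure" and H :: "nat \<Rightarrow> 'w measure" +
  fixes N :: "(real ^ 'n \<Rightarrow> real) measure"
    and X :: "(real ^ 'n) set"
    and nabla :: "(real ^ 'n \<Rightarrow> real) \<Rightarrow> real ^ 'n \<Rightarrow> real ^ 'n"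
    and P :: "nat \<Rightarrow> 'w \<Rightarrow> (real ^ 'n \<Rightarrow> real) measure"
    and f :: "nat \<Rightarrow> 'w \<Rightarrow> real ^ 'n \<Rightarrow> real"
    and T :: nat
  assumes horizon: "1 \<le> T"
    and domain: "X \<noteq> {}" "closed X" "convex X"
    and gradient:
      "\<And>\<phi> x. \<phi> \<in> space N \<Longrightarrow> x \<in> X \<Longrightarrow> has_gradient_within \<phi> (nabla \<phi> x) X x"
    and measurable_value:
      "(\<lambda>(\<phi>, x). \<phi> x) \<in> borel_measurable (N \<Otimes>\<^sub>M restrict_space borel X)"
    and measurable_gradient:
      "(\<lambda>(\<phi>, x). nabla \<phi> x) \<in> borel_measurable (N \<Otimes>\<^sub>M restrict_space borel X)"
    and history: "\<And>t. subalgebra M (H t)"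
    and distribution: "\<And>t. t \<in> {1..T} \<Longrightarrow> P t \<in> measurable (H t) (prob_algebra N)"
    and sample: "\<And>t. t \<in> {1..T} \<Longrightarrow> f t \<in> measurable (H (Suc t)) N"
    and conditional_law:
      "\<And>t A. t \<in> {1..T} \<Longrightarrow> A \<in> sets N \<Longrightarrow>
         AE \<omega> in M. real_cond_exp M (H t) (\<lambda>\<omega>. indicator A (f t \<omega>)) \<omega> = measure (P t \<omega>) A"
    and integrable_value:
      "\<And>t \<omega> x. t \<in> {1..T} \<Longrightarrow> \<omega> \<in> space M \<Longrightarrow> x \<in> X \<Longrightarrow> integrable (P t \<omega>) (\<lambda>\<phi>. \<phi> x)"
    and differentiate_expectation:
      "\<And>t \<omega> x. t \<in> {1..T} \<Longrightarrow> \<omega> \<in> space M \<Longrightarrow> x \<in> X \<Longrightarrow>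
         has_gradient_within (expected_function (P t \<omega>)) (expected_gradient nabla (P t \<omega>) x) X x"
    and measurable_variance:
      "\<And>t. t \<in> {1..T} \<Longrightarrow> (\<lambda>\<omega>. gradient_variance X nabla (P t \<omega>)) \<in> borel_measurable M"

definition cumulative_variance ::
  "'w measure \<Rightarrow> (real ^ 'n) set \<Rightarrow> ((real ^ 'n \<Rightarrow> real) \<Rightarrow> real ^ 'n \<Rightarrow> real ^ 'n)
    \<Rightarrow> (nat \<Rightarrow> 'w \<Rightarrow> (real ^ 'n \<Rightarrow> real) measure) \<Rightarrow> nat \<Rightarrow> real" where
  "cumulative_variance M X nabla P T =
     (\<integral>\<omega>. (\<Sum>t=1..T. gradient_variance X nabla (P t \<omega>)) \<partial>M)"

definition round_gradient ::
  "((real ^ 'n \<Rightarrow> real) \<Rightarrow> real ^ 'n \<Rightarrow> real ^ 'n)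
    \<Rightarrow> (nat \<Rightarrow> 'w \<Rightarrow> (real ^ 'n \<Rightarrow> real) measure) \<Rightarrow> nat \<Rightarrow> 'w \<Rightarrow> real ^ 'n \<Rightarrow> real ^ 'n" where
  "round_gradient nabla P t \<omega> x = (if t = 0 then 0 else expected_gradient nabla (P t \<omega>) x)"

definition cumulative_variation ::
  "'w measure \<Rightarrow> (real ^ 'n) set \<Rightarrow> ((real ^ 'n \<Rightarrow> real) \<Rightarrow> real ^ 'n \<Rightarrow> real ^ 'n)
    \<Rightarrow> (nat \<Rightarrow> 'w \<Rightarrow> (real ^ 'n \<Rightarrow> real) measure) \<Rightarrow> nat \<Rightarrow> real" where
  "cumulative_variation M X nabla P T =
     (\<integral>\<omega>. (\<Sum>t=1..T. SUP x\<in>X.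
        (norm (round_gradient nabla P t \<omega> x - round_gradient nabla P (t - 1) \<omega> x))\<^sup>2) \<partial>M)"

text \<open>
  Below, \<open>grad t\<close> is the gradient field of the function of round \<open>t\<close> and \<open>x t\<close> is the point played in
  round \<open>t\<close>, both along one fixed outcome. Rounds are numbered from 1; index 0 only serves the
  convention that the gradient observed before the first round is zero.
\<close>

definition observed_gradient ::
  "(nat \<Rightarrow> real ^ 'n \<Rightarrow> real ^ 'n) \<Rightarrow> (nat \<Rightarrow> real ^ 'n) \<Rightarrow> nat \<Rightarrow> real ^ 'n" where
  "observed_gradient grad x t = (if t = 0 then 0 else grad t (x t))"

definition adaptive_step ::
  "real \<Rightarrow> real \<Rightarrow> real \<Rightarrow> (nat \<Rightarrow> real ^ 'n) \<Rightarrow> nat \<Rightarrow> real" where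
  "adaptive_step D G \<delta> g t =
     D / sqrt (\<delta> + 4 * G\<^sup>2 + (\<Sum>s=1..t-1. (norm (g s - g (s - 1)))\<^sup>2))"

definition optimistic_omd ::
  "(real ^ 'n) set \<Rightarrow> (nat \<Rightarrow> real) \<Rightarrow> nat \<Rightarrow> real ^ 'n
    \<Rightarrow> (nat \<Rightarrow> real ^ 'n \<Rightarrow> real ^ 'n) \<Rightarrow> (nat \<Rightarrow> real ^ 'n) \<Rightarrow> (nat \<Rightarrow> real ^ 'n) \<Rightarrow> bool" where
  "optimistic_omd X \<eta> T x1 grad x xhat \<longleftrightarrow>
     x 1 = x1 \<and> xhat 1 = x1 \<and>
     (\<forall>t\<in>{1..T}.
        xhat (t + 1) = closest_point X (xhat t - \<eta> t *\<^sub>R grad t (x t)) \<and>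
        x (t + 1) = closest_point X (xhat (t + 1) - \<eta> (t + 1) *\<^sub>R grad t (x t)))"

text \<open>
  Having no argument besides \<open>D\<close>, \<open>G\<close> and \<open>L\<close>, this constant is uniform in the dimension, the domain,
  the horizon and the probability space. An existentially quantified constant in a theorem about
  \<open>real ^ 'n\<close> could depend on the type \<open>'n\<close>, hence on the dimension.
\<close>

definition regret_constant :: "real \<Rightarrow> real \<Rightarrow> real \<Rightarrow> real" where
  "regret_constant D G L = 5 * sqrt 10 * D\<^sup>2 * L + 5 * sqrt 5 * D * G / 2 + 5 * sqrt 2 * D"

end

theory Submission
  imports Defs
begin

text \<open>
  Along one outcome, the projection inequalities bound the linearized regret by
  \<open>\<Sum> \<eta>\<^sub>t \<parallel>g\<^sub>t - g\<^sub>t\<^sub>-\<^sub>1\<parallel>\<^sup>2 + D\<^sup>2 / (2 \<eta>\<^sub>T)\<close> minus a multiple of the squared path length of the iterates.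
  The adaptive step sizes turn the first two terms into the square root of
  \<open>\<delta> + 4 G\<^sup>2 + \<Sum> \<parallel>g\<^sub>t - g\<^sub>t\<^sub>-\<^sub>1\<parallel>\<^sup>2\<close>. Each difference of gradients splits into the noise of rounds
  \<open>t\<close> and \<open>t - 1\<close>, the variation of the expected gradient, and a smoothness term, which the
  negative path length absorbs. Since the iterate of round \<open>t\<close> is known before \<open>f\<^sub>t\<close> is drawn, the
  conditional law replaces \<open>f\<^sub>t\<close> by its expected function, where convexity applies, and bounds the
  expected noise by the variance; \<open>E sqrt Y \<le> sqrt (E Y)\<close> finishes the proof.
\<close>

section \<open>Optimistic mirror descent along one outcome\<close>

text \<open>Two facts fail along a single outcome. A sampled function may be nonconvex, so its loss
  is not bounded by its linearization. The variance is a supremum of expectations, so it says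
  nothing about the noise at a point chosen after the sample is seen. Both facts become true once
  the iterate is frozen and the sample is averaged out. The hypothesis
  \<open>conditional_law\<close> treats one event at a time, whereas the quantities to be averaged
  depend jointly on the past, through the iterate, and on the sample. It is therefore first
  strengthened to a statement about the joint law of past and sample. Everything about the algorithm
  itself is deterministic and uses neither convexity of the losses nor probability.\<close>

lemma closest_point_three_point:
  fixes a c u :: "'a::euclidean_space"
  assumes "convex S" "closed S" "u \<in> S"
  defines "p \<equiv> closest_point S (a - c)"
  shows "c \<bullet> (p - u) \<le> ((norm (u - a))\<^sup>2 - (norm (u - p))\<^sup>2 - (norm (p - a))\<^sup>2) / 2"
proof -
  have "(a - c - p) \<bullet> (u - p) \<le> 0"
    unfolding p_def by (rule closest_point_dot[OF assms(1-3)])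
  moreover have "(norm (u - a))\<^sup>2 - (norm (u - p))\<^sup>2 - (norm (p - a))\<^sup>2 = 2 * ((p - a) \<bullet> (u - p))"
    unfolding power2_norm_eq_inner by (simp add: inner_diff_left inner_diff_right inner_commute algebra_simps)
  ultimately show ?thesis
    by (simp add: inner_diff_left inner_diff_right inner_commute algebra_simps)
qed

text \<open>Both projections start from the same point \<open>a\<close>: the played point
  \<open>y\<close> uses the guess \<open>c\<close>, the auxiliary point \<open>z\<close> uses the
  gradient \<open>g\<close> revealed afterwards. The regret of \<open>y\<close> against
  \<open>u\<close> is split at \<open>z\<close>, so that a wrong guess is paid for only through
  \<open>g - c\<close>.\<close>

lemma optimistic_step:
  fixes c g a y z u :: "'a::euclidean_space"
  assumes S: "convex S" "closed S" "u \<in> S" and eta: "0 < \<eta>"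
    and z: "z = closest_point S (a - \<eta> *\<^sub>R g)" and y: "y = closest_point S (a - \<eta> *\<^sub>R c)"
  shows "g \<bullet> (y - u) \<le> \<eta> * (norm (g - c))\<^sup>2
           + ((norm (u - a))\<^sup>2 - (norm (u - z))\<^sup>2) / (2 * \<eta>)
           - ((norm (z - y))\<^sup>2 + (norm (y - a))\<^sup>2) / (2 * \<eta>)"
proof -
  have ne: "S \<noteq> {}" using S by auto
  have zS: "z \<in> S" unfolding z by (rule closest_point_in_set[OF S(2) ne])
  have 1: "(\<eta> *\<^sub>R g) \<bullet> (z - u) \<le> ((norm (u - a))\<^sup>2 - (norm (u - z))\<^sup>2 - (norm (z - a))\<^sup>2) / 2"
    unfolding z by (rule closest_point_three_point[OF S])
  \<comment> \<open>Taking \<open>z\<close> as the comparator of \<open>y\<close> makes the positive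
    \<open>(norm (z - a))\<^sup>2\<close> here cancel the negative one in \<open>1\<close>.\<close>
  have 2: "(\<eta> *\<^sub>R c) \<bullet> (y - z) \<le> ((norm (z - a))\<^sup>2 - (norm (z - y))\<^sup>2 - (norm (y - a))\<^sup>2) / 2"
    unfolding y by (rule closest_point_three_point[OF S(1,2) zS])
  txt \<open>
    Nonexpansiveness instead of the AM-GM inequality keeps the full negative terms;
    splitting with AM-GM would lose the constant \<open>5 sqrt 10\<close> of the theorem.
  \<close>
  have "dist y z \<le> dist (a - \<eta> *\<^sub>R c) (a - \<eta> *\<^sub>R g)"
    unfolding y z by (rule closest_point_lipschitz[OF S(1,2) ne])
  also have "\<dots> = \<eta> * norm (g - c)"
    using eta by (simp add: dist_norm scaleR_diff_right[symmetric])
  finally have d: "norm (y - z) \<le> \<eta> * norm (g - c)" by (simp add: dist_norm)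
  have "(g - c) \<bullet> (y - z) \<le> norm (g - c) * norm (y - z)" by (rule norm_cauchy_schwarz)
  also have "\<dots> \<le> norm (g - c) * (\<eta> * norm (g - c))" using d by (intro mult_left_mono) auto
  finally have 3: "\<eta> * ((g - c) \<bullet> (y - z)) \<le> \<eta> * (\<eta> * (norm (g - c))\<^sup>2)"
    using eta by (intro mult_left_mono) (simp_all add: power2_eq_square mult_ac)
  have "\<eta> * (g \<bullet> (y - u)) = \<eta> * ((g - c) \<bullet> (y - z)) + (\<eta> *\<^sub>R c) \<bullet> (y - z) + (\<eta> *\<^sub>R g) \<bullet> (z - u)"
    by (simp add: inner_diff_left inner_diff_right algebra_simps)
  also have "\<dots> \<le> \<eta> * (\<eta> * (norm (g - c))\<^sup>2) + ((norm (u - a))\<^sup>2 - (norm (u - z))\<^sup>2) / 2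
           - ((norm (z - y))\<^sup>2 + (norm (y - a))\<^sup>2) / 2"
    using 1 2 3 by (simp add: field_simps)
  also have "\<dots> = \<eta> * (\<eta> * (norm (g - c))\<^sup>2
           + ((norm (u - a))\<^sup>2 - (norm (u - z))\<^sup>2) / (2 * \<eta>)
           - ((norm (z - y))\<^sup>2 + (norm (y - a))\<^sup>2) / (2 * \<eta>))"
    using eta by (simp add: field_simps)
  finally show ?thesis using eta by simp
qed

text \<open>Summation by parts for nondecreasing weights. Keeping the slack
  \<open>B - a (Suc n)\<close> in the bound is what lets the induction run: the slack is nonnegative
  in the next round, so raising its weight from \<open>w n\<close> to \<open>w (Suc n)\<close> is
  harmless and the sum telescopes.\<close>

lemma sum_mult_diff_le:
  fixes w a :: "nat \<Rightarrow> real"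
  assumes "1 \<le> n" "\<And>t. t \<in> {1..n} \<Longrightarrow> a t \<le> B" "\<And>t. t \<in> {1..n} \<Longrightarrow> 0 \<le> w t"
    and "\<And>t. 1 \<le> t \<Longrightarrow> t < n \<Longrightarrow> w t \<le> w (Suc t)"
  shows "(\<Sum>t=1..n. w t * (a t - a (Suc t))) \<le> w n * (B - a (Suc n))"
  using assms
proof (induction n rule: nat_induct_at_least)
  case base
  then show ?case by (auto intro!: mult_left_mono)
next
  case (Suc n)
  have "(\<Sum>t=1..Suc n. w t * (a t - a (Suc t)))
      \<le> w n * (B - a (Suc n)) + w (Suc n) * (a (Suc n) - a (Suc (Suc n)))"
    using Suc by simp
  also have "w n * (B - a (Suc n)) \<le> w (Suc n) * (B - a (Suc n))"
    using Suc by (intro mult_right_mono) auto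
  finally show ?case by (simp add: algebra_simps)
qed

text \<open>A discrete version of integrating \<open>1 / sqrt\<close> to \<open>2 * sqrt\<close>.
  With \<open>p\<close> and \<open>q\<close> the square roots before and after adding
  \<open>v (Suc n)\<close>, the new summand is at most the increment \<open>2 * q - 2 * p\<close>,
  because the difference of the two sides, multiplied by \<open>q\<close>, is
  \<open>(q - p)\<^sup>2\<close>.\<close>

lemma sum_divide_sqrt_le:
  fixes v :: "nat \<Rightarrow> real"
  assumes "0 < c" "\<And>t. 0 \<le> v t"
  shows "(\<Sum>t=1..n. v t / sqrt (c + (\<Sum>s=1..t. v s))) \<le> 2 * sqrt (c + (\<Sum>s=1..n. v s))"
proof (induction n)
  case 0
  then show ?case using assms by simp
next
  case (Suc n)
  define p where "p = sqrt (c + (\<Sum>s=1..n. v s))"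
  define q where "q = sqrt (c + (\<Sum>s=1..Suc n. v s))"
  have V: "0 \<le> (\<Sum>s=1..n. v s)" "0 \<le> (\<Sum>s=1..Suc n. v s)" using assms by (intro sum_nonneg; simp)+
  have p: "p\<^sup>2 = c + (\<Sum>s=1..n. v s)" "0 \<le> p" unfolding p_def using V assms by auto
  have q: "q\<^sup>2 = p\<^sup>2 + v (Suc n)" "0 < q"
    unfolding q_def p using V assms(1) by (simp_all del: sum.cl_ivl_Suc) simp
  have "v (Suc n) / q \<le> 2 * q - 2 * p"
  proof -
    have "0 \<le> (q - p)\<^sup>2" by simp
    hence "v (Suc n) \<le> (2 * q - 2 * p) * q" using q by (simp add: power2_eq_square algebra_simps)
    thus ?thesis using q by (simp add: pos_divide_le_eq)
  qed
  moreover have "(\<Sum>t=1..n. v t / sqrt (c + (\<Sum>s=1..t. v s))) \<le> 2 * p" using Suc p_def by simp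
  ultimately show ?case unfolding q_def[symmetric] by (simp add: q_def)
qed

lemma norm_diff_sq_le:
  fixes a b :: "'a::real_inner"
  shows "(norm (a - b))\<^sup>2 \<le> 2 * (norm a)\<^sup>2 + 2 * (norm b)\<^sup>2"
proof -
  have "0 \<le> (norm (a + b))\<^sup>2" by simp
  thus ?thesis unfolding power2_norm_eq_inner
    by (simp add: inner_add_left inner_add_right inner_diff_left inner_diff_right inner_commute)
qed

lemma norm_add4_sq_le:
  fixes a b c d :: "'a::real_inner"
  shows "(norm (a + b + c + d))\<^sup>2 \<le> 4 * ((norm a)\<^sup>2 + (norm b)\<^sup>2 + (norm c)\<^sup>2 + (norm d)\<^sup>2)"
proof -
  have "a + b + c + d = (a + b) - (- c - d)" by simp
  hence "(norm (a + b + c + d))\<^sup>2 \<le> 2 * (norm (a + b))\<^sup>2 + 2 * (norm (- c - d))\<^sup>2"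
    using norm_diff_sq_le[of "a + b" "- c - d"] by (simp only:)
  also have "\<dots> \<le> 2 * (2 * (norm a)\<^sup>2 + 2 * (norm b)\<^sup>2) + 2 * (2 * (norm c)\<^sup>2 + 2 * (norm d)\<^sup>2)"
    using norm_diff_sq_le[of a "- b"] norm_diff_sq_le[of "- c" d] by simp
  finally show ?thesis by simp
qed

text \<open>After the shift of \<open>A\<close> by one round, every \<open>A t\<close> and
  \<open>B t\<close> is counted at most once. This serves both the path length, where a move passes
  through \<open>xhat t\<close>, and the noise, which enters two consecutive gradient
  differences.\<close>

lemma sum_lagged_le:
  fixes r A B :: "nat \<Rightarrow> real"
  assumes "\<And>t. t \<in> {2..n} \<Longrightarrow> r t \<le> 2 * (A (t - 1) + B t)"
    and "\<And>t. t \<in> {1..n} \<Longrightarrow> 0 \<le> A t" "\<And>t. t \<in> {1..n} \<Longrightarrow> 0 \<le> B t"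
  shows "(\<Sum>t=2..n. r t) \<le> 2 * (\<Sum>t=1..n. A t + B t)"
proof (cases n)
  case (Suc m)
  have eq: "(\<Sum>t=2..n. A (t - 1)) = (\<Sum>t=1..m. A t)"
    by (rule sum.reindex_bij_witness[of _ Suc "\<lambda>t. t - 1"]) (auto simp: Suc)
  have "(\<Sum>t=2..n. r t) \<le> (\<Sum>t=2..n. 2 * (A (t - 1) + B t))" by (intro sum_mono assms(1))
  also have "\<dots> = 2 * ((\<Sum>t=1..m. A t) + (\<Sum>t=2..n. B t))"
    by (simp add: sum_distrib_left[symmetric] sum.distrib eq[unfolded One_nat_def])
  also have "\<dots> \<le> 2 * ((\<Sum>t=1..n. A t) + (\<Sum>t=1..n. B t))"
    using assms(2,3) Suc by (intro mult_left_mono add_mono sum_mono2) auto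
  finally show ?thesis by (simp add: sum.distrib)
qed simp

section \<open>Regret of optimistic mirror descent with adaptive steps\<close>

lemma optimistic_omd_in_domain:
  assumes "optimistic_omd X \<eta> T x1 grad x xhat" "closed X" "x1 \<in> X" "t \<in> {1..Suc T}"
  shows "x t \<in> X" "xhat t \<in> X"
proof -
  have ne: "X \<noteq> {}" using assms by auto
  have "x t \<in> X \<and> xhat t \<in> X"
  proof (cases "t = 1")
    case False
    then have "t - 1 \<in> {1..T}" "t = (t - 1) + 1" using assms(4) by auto
    then show ?thesis using assms(1) closest_point_in_set[OF assms(2) ne]
      unfolding optimistic_omd_def by metis
  qed (use assms in \<open>auto simp: optimistic_omd_def\<close>)
  thus "x t \<in> X" "xhat t \<in> X" by auto
qed

text \<open>The gradient bound is imposed at the played points only, which is the form in which it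
  later holds for almost every outcome.\<close>

lemma optimistic_omd_regret:
  fixes X :: "(real ^ 'n) set" and x xhat :: "nat \<Rightarrow> real ^ 'n" and grad D G
  defines "g \<equiv> observed_gradient grad x"
  assumes omd: "optimistic_omd X (adaptive_step D G \<delta> g) T x1 grad x xhat"
    and X: "convex X" "closed X" and x1: "x1 \<in> X" and u: "u \<in> X"
    and diameter: "\<And>y z. y \<in> X \<Longrightarrow> z \<in> X \<Longrightarrow> norm (y - z) \<le> D"
    and bound: "\<And>t. t \<in> {1..T} \<Longrightarrow> norm (grad t (x t)) \<le> G"
    and "1 \<le> T" "0 < D" "0 < \<delta>"
  shows "(\<Sum>t=1..T. g t \<bullet> (x t - u))
           \<le> 5 / 2 * D * sqrt (\<delta> + 4 * G\<^sup>2 + (\<Sum>t=1..T. (norm (g t - g (t - 1)))\<^sup>2))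
             - sqrt \<delta> / (4 * D) * (\<Sum>t=2..T. (norm (x t - x (t - 1)))\<^sup>2)"
proof -
  define v where "v t = (norm (g t - g (t - 1)))\<^sup>2" for t
  define V where "V n = (\<Sum>s=1..n. v s)" for n
  define \<eta> where "\<eta> t = adaptive_step D G \<delta> g t" for t
  define w where "w t = 1 / (2 * \<eta> t)" for t
  define a where "a t = (norm (u - xhat t))\<^sup>2" for t
  have v0: "0 \<le> v t" for t by (simp add: v_def)
  have V0: "0 \<le> V n" for n by (simp add: V_def v0 sum_nonneg)
  have V_mono: "V m \<le> V n" if "m \<le> n" for m n
    unfolding V_def using that v0 by (intro sum_mono2) auto
  have \<eta>: "\<eta> t = D / sqrt (\<delta> + 4 * G\<^sup>2 + V (t - 1))" for t
    by (simp add: \<eta>_def adaptive_step_def V_def v_def)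
  have arg: "0 < \<delta> + 4 * G\<^sup>2 + V n" for n
    using \<open>0 < \<delta>\<close> V0[of n] by (intro add_pos_nonneg) auto
  have \<eta>_pos: "0 < \<eta> t" for t unfolding \<eta> using arg \<open>0 < D\<close> by simp
  have w: "w t = sqrt (\<delta> + 4 * G\<^sup>2 + V (t - 1)) / (2 * D)" for t
    unfolding w_def \<eta> by simp
  have g: "g t = grad t (x t)" if "1 \<le> t" for t using that by (simp add: g_def observed_gradient_def)
  have g0: "g 0 = 0" by (simp add: g_def observed_gradient_def)
  \<comment> \<open>Index 0 needs \<open>0 \<le> G\<close>, which follows from the bound in round
    1.\<close>
  have gG: "norm (g t) \<le> G" if "t \<le> T" for t
    using that bound[of t] bound[of 1] norm_ge_zero[of "grad 1 (x 1)"] \<open>1 \<le> T\<close> g0 g[of t]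
    by (cases "t = 0") (auto simp del: norm_ge_zero)
  have v_le: "v t \<le> 4 * G\<^sup>2" if "t \<le> T" for t
  proof -
    have "norm (g t - g (t - 1)) \<le> 2 * G"
      using norm_triangle_ineq4[of "g t" "g (t - 1)"] gG[of t] gG[of "t - 1"] that by linarith
    hence "v t \<le> (2 * G)\<^sup>2" unfolding v_def by (intro power_mono) auto
    thus ?thesis by simp
  qed
  have step: "g t \<bullet> (x t - u) \<le> \<eta> t * v t + w t * (a t - a (Suc t))
      - w t * ((norm (xhat (Suc t) - x t))\<^sup>2 + (norm (x t - xhat t))\<^sup>2)" if t: "t \<in> {1..T}" for t
  proof -
    have z: "xhat (Suc t) = closest_point X (xhat t - \<eta> t *\<^sub>R g t)"
      using omd t unfolding optimistic_omd_def \<eta>_def by (simp add: g)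
    \<comment> \<open>Round 1 obeys the same recursion because \<open>g 0\<close> is zero and
      \<open>x1\<close>, lying in \<open>X\<close>, is its own projection.\<close>
    have y: "x t = closest_point X (xhat t - \<eta> t *\<^sub>R g (t - 1))"
    proof (cases "t = 1")
      case True
      then show ?thesis using omd x1 by (simp add: optimistic_omd_def g0 closest_point_self)
    next
      case False
      then have "t - 1 \<in> {1..T}" "t = (t - 1) + 1" using t by auto
      then show ?thesis using omd g unfolding optimistic_omd_def \<eta>_def by (metis atLeastAtMost_iff)
    qed
    show ?thesis
      using optimistic_step[OF X u \<eta>_pos z y] unfolding v_def w_def a_def by simp
  qed
  have I1: "(\<Sum>t=1..T. \<eta> t * v t) \<le> 2 * D * sqrt (\<delta> + 4 * G\<^sup>2 + V T)"
  proof -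
    have "(\<Sum>t=1..T. \<eta> t * v t) \<le> (\<Sum>t=1..T. D * (v t / sqrt (\<delta> + (\<Sum>s=1..t. v s))))"
    proof (rule sum_mono)
      fix t assume t: "t \<in> {1..T}"
      have "V t = V (t - 1) + v t" unfolding V_def using t by (cases t) auto
      \<comment> \<open>The step size of round \<open>t\<close> cannot contain \<open>v t\<close>,
        which is not yet observed. The summand \<open>4 * G\<^sup>2\<close> dominates it, so the
        lagged sum can be replaced by the one that includes round \<open>t\<close>.\<close>
      hence "\<delta> + V t \<le> \<delta> + 4 * G\<^sup>2 + V (t - 1)" using v_le[of t] t by simp
      moreover have "0 < \<delta> + V t" using V0[of t] \<open>0 < \<delta>\<close> by simp
      ultimately have "\<eta> t \<le> D / sqrt (\<delta> + V t)"
        unfolding \<eta> using \<open>0 < D\<close> by (intro divide_left_mono) (auto intro!: mult_pos_pos)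
      from mult_right_mono[OF this v0[of t]]
      show "\<eta> t * v t \<le> D * (v t / sqrt (\<delta> + (\<Sum>s=1..t. v s)))" by (simp add: V_def)
    qed
    also have "\<dots> = D * (\<Sum>t=1..T. v t / sqrt (\<delta> + (\<Sum>s=1..t. v s)))" by (simp add: sum_distrib_left)
    also have "\<dots> \<le> D * (2 * sqrt (\<delta> + V T))"
      unfolding V_def using \<open>0 < D\<close> v0 \<open>0 < \<delta>\<close> by (intro mult_left_mono sum_divide_sqrt_le) auto
    also have "\<dots> \<le> D * (2 * sqrt (\<delta> + 4 * G\<^sup>2 + V T))"
      using \<open>0 < D\<close> by (intro mult_left_mono) auto
    finally show ?thesis by simp
  qed
  have I2: "(\<Sum>t=1..T. w t * (a t - a (Suc t))) \<le> D / 2 * sqrt (\<delta> + 4 * G\<^sup>2 + V T)"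
  proof -
    have "(\<Sum>t=1..T. w t * (a t - a (Suc t))) \<le> w T * (D\<^sup>2 - a (Suc T))"
    proof (rule sum_mult_diff_le[OF \<open>1 \<le> T\<close>])
      show "a t \<le> D\<^sup>2" if "t \<in> {1..T}" for t unfolding a_def
        using that by (intro power_mono diameter u optimistic_omd_in_domain[OF omd X(2) x1]) auto
      show "0 \<le> w t" for t unfolding w_def using \<eta>_pos[of t] by simp
      show "w t \<le> w (Suc t)" for t unfolding w
        using \<open>0 < D\<close> V_mono[of "t - 1" t] by (intro divide_right_mono) auto
    qed
    also have "\<dots> \<le> w T * D\<^sup>2" using \<eta>_pos[of T] by (intro mult_left_mono) (auto simp: a_def w_def)
    also have "\<dots> = D / 2 * sqrt (\<delta> + 4 * G\<^sup>2 + V (T - 1))"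
      unfolding w using \<open>0 < D\<close> by (simp add: power2_eq_square)
    also have "\<dots> \<le> D / 2 * sqrt (\<delta> + 4 * G\<^sup>2 + V T)"
      using \<open>0 < D\<close> V_mono[of "T - 1" T] by (intro mult_left_mono) auto
    finally show ?thesis .
  qed
  \<comment> \<open>The summand \<open>\<delta>\<close> keeps every weight \<open>w t\<close> above
    \<open>sqrt \<delta> / (2 * D)\<close>. The other factor 1/2 is the price of passing from
    \<open>x (t - 1)\<close> to \<open>x t\<close> through \<open>xhat t\<close>.\<close>
  have I3: "sqrt \<delta> / (4 * D) * (\<Sum>t=2..T. (norm (x t - x (t - 1)))\<^sup>2)
      \<le> (\<Sum>t=1..T. w t * ((norm (xhat (Suc t) - x t))\<^sup>2 + (norm (x t - xhat t))\<^sup>2))"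
  proof -
    have "(\<Sum>t=2..T. (norm (x t - x (t - 1)))\<^sup>2)
        \<le> 2 * (\<Sum>t=1..T. (norm (xhat (Suc t) - x t))\<^sup>2 + (norm (x t - xhat t))\<^sup>2)"
    proof (rule sum_lagged_le)
      fix t assume t: "t \<in> {2..T}"
      then have "Suc (t - 1) = t" by auto
      then show "(norm (x t - x (t - 1)))\<^sup>2
          \<le> 2 * ((norm (xhat (Suc (t - 1)) - x (t - 1)))\<^sup>2 + (norm (x t - xhat t))\<^sup>2)"
        using norm_diff_sq_le[of "x t - xhat t" "x (t - 1) - xhat t"] by (simp add: norm_minus_commute)
    qed auto
    hence "sqrt \<delta> / (4 * D) * (\<Sum>t=2..T. (norm (x t - x (t - 1)))\<^sup>2)
        \<le> sqrt \<delta> / (4 * D) * (2 * (\<Sum>t=1..T. (norm (xhat (Suc t) - x t))\<^sup>2 + (norm (x t - xhat t))\<^sup>2))"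
      using \<open>0 < \<delta>\<close> \<open>0 < D\<close> by (intro mult_left_mono) auto
    also have "\<dots> = (\<Sum>t=1..T. sqrt \<delta> / (2 * D) * ((norm (xhat (Suc t) - x t))\<^sup>2 + (norm (x t - xhat t))\<^sup>2))"
      by (subst sum_distrib_left[symmetric]) simp
    also have "\<dots> \<le> (\<Sum>t=1..T. w t * ((norm (xhat (Suc t) - x t))\<^sup>2 + (norm (x t - xhat t))\<^sup>2))"
    proof (rule sum_mono, rule mult_right_mono)
      show "sqrt \<delta> / (2 * D) \<le> w t" for t unfolding w
        using \<open>0 < D\<close> V0 by (intro divide_right_mono) auto
    qed simp
    finally show ?thesis .
  qed
  have "(\<Sum>t=1..T. g t \<bullet> (x t - u)) \<le> (\<Sum>t=1..T. \<eta> t * v t + w t * (a t - a (Suc t))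
      - w t * ((norm (xhat (Suc t) - x t))\<^sup>2 + (norm (x t - xhat t))\<^sup>2))"
    by (intro sum_mono step)
  also have "\<dots> = (\<Sum>t=1..T. \<eta> t * v t) + (\<Sum>t=1..T. w t * (a t - a (Suc t)))
      - (\<Sum>t=1..T. w t * ((norm (xhat (Suc t) - x t))\<^sup>2 + (norm (x t - xhat t))\<^sup>2))"
    by (simp add: sum.distrib sum_subtractf)
  \<comment> \<open>The factor 5/2 is 2 from \<open>I1\<close> plus 1/2 from
    \<open>I2\<close>.\<close>
  finally show ?thesis using I1 I2 I3 by (simp add: V_def v_def)
qed

text \<open>Splitting a difference into four terms costs a factor 4, and the noise of one round
  appears in two consecutive differences, hence the 8. Round 1 has no predecessor and is charged
  \<open>G\<^sup>2\<close> directly. Together with the \<open>4 * G\<^sup>2\<close> of the step size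
  this gives the \<open>sqrt 5\<close> of the final bound.\<close>

lemma sum_gradient_change_le:
  fixes F :: "nat \<Rightarrow> 'a::real_inner \<Rightarrow> 'a"
  assumes "g 0 = 0" "norm (g 1) \<le> G"
    and x: "\<And>t. t \<in> {1..T} \<Longrightarrow> x t \<in> X"
    and smooth: "\<And>t y z. t \<in> {1..T} \<Longrightarrow> y \<in> X \<Longrightarrow> z \<in> X \<Longrightarrow> norm (F t y - F t z) \<le> L * norm (y - z)"
  shows "(\<Sum>t=1..T. (norm (g t - g (t - 1)))\<^sup>2)
     \<le> G\<^sup>2 + 8 * (\<Sum>t=1..T. (norm (g t - F t (x t)))\<^sup>2)
        + 4 * (\<Sum>t=1..T. (norm (F t (x t) - F (t - 1) (x t)))\<^sup>2)
        + 4 * L\<^sup>2 * (\<Sum>t=2..T. (norm (x t - x (t - 1)))\<^sup>2)"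
proof -
  let ?n = "\<lambda>t. (norm (g t - F t (x t)))\<^sup>2"
  let ?b = "\<lambda>t. (norm (F t (x t) - F (t - 1) (x t)))\<^sup>2"
  have "(\<Sum>t=1..T. (norm (g t - g (t - 1)))\<^sup>2) \<le> G\<^sup>2 + (\<Sum>t=2..T. (norm (g t - g (t - 1)))\<^sup>2)"
  proof (cases "T = 0")
    case False
    have "(norm (g 1))\<^sup>2 \<le> G\<^sup>2" using assms(2) by (intro power_mono) auto
    thus ?thesis using False assms(1) by (simp add: sum.atLeast_Suc_atMost numeral_2_eq_2)
  qed simp
  also have "(\<Sum>t=2..T. (norm (g t - g (t - 1)))\<^sup>2)
      \<le> (\<Sum>t=2..T. 4 * (?n (t - 1) + ?n t) + (4 * ?b t + 4 * L\<^sup>2 * (norm (x t - x (t - 1)))\<^sup>2))"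
  proof (rule sum_mono)
    fix t assume t: "t \<in> {2..T}"
    have "norm (F (t - 1) (x t) - F (t - 1) (x (t - 1))) \<le> L * norm (x t - x (t - 1))"
      using t by (intro smooth x) auto
    hence "(norm (F (t - 1) (x t) - F (t - 1) (x (t - 1))))\<^sup>2 \<le> (L * norm (x t - x (t - 1)))\<^sup>2"
      by (intro power_mono) auto
    moreover have "g t - g (t - 1) = (g t - F t (x t)) + (F t (x t) - F (t - 1) (x t))
        + (F (t - 1) (x t) - F (t - 1) (x (t - 1))) + - (g (t - 1) - F (t - 1) (x (t - 1)))" by simp
    ultimately show "(norm (g t - g (t - 1)))\<^sup>2
        \<le> 4 * (?n (t - 1) + ?n t) + (4 * ?b t + 4 * L\<^sup>2 * (norm (x t - x (t - 1)))\<^sup>2)"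
      using norm_add4_sq_le[of "g t - F t (x t)" "F t (x t) - F (t - 1) (x t)"
        "F (t - 1) (x t) - F (t - 1) (x (t - 1))" "- (g (t - 1) - F (t - 1) (x (t - 1)))"]
      unfolding norm_minus_cancel power_mult_distrib by simp
  qed
  also have "\<dots> = (\<Sum>t=2..T. 4 * (?n (t - 1) + ?n t)) + 4 * (\<Sum>t=2..T. ?b t)
      + 4 * L\<^sup>2 * (\<Sum>t=2..T. (norm (x t - x (t - 1)))\<^sup>2)"
    by (simp add: sum.distrib sum_distrib_left)
  also have "(\<Sum>t=2..T. 4 * (?n (t - 1) + ?n t)) \<le> 2 * (\<Sum>t=1..T. 2 * ?n t + 2 * ?n t)"
    by (rule sum_lagged_le) auto
  also have "2 * (\<Sum>t=1..T. 2 * ?n t + 2 * ?n t) = 8 * (\<Sum>t=1..T. ?n t)"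
    by (simp add: sum_distrib_left)
  also have "(\<Sum>t=2..T. ?b t) \<le> (\<Sum>t=1..T. ?b t)" by (intro sum_mono2) auto
  finally show ?thesis by simp
qed

text \<open>This is where \<open>\<delta> = 10 * D\<^sup>2 * L\<^sup>2\<close> comes from. If
  \<open>sqrt \<delta> = q * D * L\<close>, then \<open>\<delta>\<close> itself contributes
  \<open>5 / 2 * q * D\<^sup>2 * L\<close>, and the smoothness term left after subtracting the path
  length contributes at most \<open>25 / q * D\<^sup>2 * L\<close>. The sum is smallest when the two
  agree, that is for \<open>q\<^sup>2 = 10\<close>, and then equals
  \<open>5 * sqrt 10 * D\<^sup>2 * L\<close>. The other coefficients are 5/2 times
  \<open>sqrt 5\<close>, \<open>sqrt 8\<close> and \<open>sqrt 4\<close>.\<close>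

lemma regret_bound_arith:
  fixes D G L N B S :: real
  assumes "0 < D" "0 < G" "0 < L" "0 \<le> N" "0 \<le> B" "0 \<le> S"
    and V: "V \<le> G\<^sup>2 + 8 * N + 4 * B + 4 * L\<^sup>2 * S"
  shows "5 / 2 * D * sqrt (10 * D\<^sup>2 * L\<^sup>2 + 4 * G\<^sup>2 + V) - sqrt (10 * D\<^sup>2 * L\<^sup>2) / (4 * D) * S
     \<le> 5 * sqrt 10 * D\<^sup>2 * L + 5 * sqrt 5 * D * G / 2 + 5 * sqrt 2 * D * sqrt N + 5 * D * sqrt B"
proof -
  define q where "q = sqrt (10 :: real)"
  define s where "s = sqrt S"
  have q: "q\<^sup>2 = 10" "0 < q" by (simp_all add: q_def)
  have s: "s\<^sup>2 = S" using assms by (simp add: s_def)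
  have d: "sqrt (10 * D\<^sup>2 * L\<^sup>2) = q * D * L" using assms by (simp add: real_sqrt_mult q_def)
  have "sqrt (10 * D\<^sup>2 * L\<^sup>2 + 4 * G\<^sup>2 + V)
      \<le> sqrt (10 * D\<^sup>2 * L\<^sup>2 + (5 * G\<^sup>2 + (8 * N + (4 * B + 4 * L\<^sup>2 * S))))"
    using V by simp
  also have "\<dots> \<le> sqrt (10 * D\<^sup>2 * L\<^sup>2) + (sqrt (5 * G\<^sup>2) + (sqrt (8 * N) + (sqrt (4 * B) + sqrt (4 * L\<^sup>2 * S))))"
    using assms by (intro order_trans[OF sqrt_add_le_add_sqrt] add_mono order_refl add_nonneg_nonneg) auto
  also have "sqrt (5 * G\<^sup>2) = sqrt 5 * G" using assms by (simp add: real_sqrt_mult)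
  also have "sqrt (8 * N) = 2 * sqrt 2 * sqrt N"
    using real_sqrt_mult[of 4 2] by (simp add: real_sqrt_mult)
  also have "sqrt (4 * B) = 2 * sqrt B" by (simp add: real_sqrt_mult)
  also have "sqrt (4 * L\<^sup>2 * S) = 2 * L * s" using assms by (simp add: real_sqrt_mult s_def)
  finally have "5 / 2 * D * sqrt (10 * D\<^sup>2 * L\<^sup>2 + 4 * G\<^sup>2 + V)
      \<le> 5 / 2 * D * (q * D * L + (sqrt 5 * G + (2 * sqrt 2 * sqrt N + (2 * sqrt B + 2 * L * s))))"
    using assms unfolding d by (intro mult_left_mono) auto
  moreover have "5 * D * L * s - q * L / 4 * s\<^sup>2 \<le> 5 / 2 * q * D\<^sup>2 * L"
  proof -
    \<comment> \<open>Completing the square: \<open>s = q * D\<close> maximizes the left-hand side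
      of the claim.\<close>
    have "0 \<le> q * L / 4 * (s - q * D)\<^sup>2" using q assms by simp
    also have "\<dots> = q * L / 4 * s\<^sup>2 - q\<^sup>2 * L / 2 * D * s + q * q\<^sup>2 * L / 4 * D\<^sup>2"
      by (simp add: power2_eq_square field_simps)
    finally show ?thesis unfolding q by (simp add: algebra_simps)
  qed
  moreover have "sqrt (10 * D\<^sup>2 * L\<^sup>2) / (4 * D) * S = q * L / 4 * s\<^sup>2"
    unfolding d s using assms by simp
  ultimately show ?thesis unfolding q_def[symmetric] by (simp add: algebra_simps power2_eq_square)
qed

lemma optimistic_omd_regret_smooth:
  fixes X :: "(real ^ 'n) set" and x xhat :: "nat \<Rightarrow> real ^ 'n" and grad D G L
    and F :: "nat \<Rightarrow> real ^ 'n \<Rightarrow> real ^ 'n"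
  assumes omd: "optimistic_omd X (adaptive_step D G (10 * D\<^sup>2 * L\<^sup>2) (observed_gradient grad x))
                  T x1 grad x xhat"
    and X: "convex X" "closed X" and x1: "x1 \<in> X" and u: "u \<in> X"
    and diameter: "\<And>y z. y \<in> X \<Longrightarrow> z \<in> X \<Longrightarrow> norm (y - z) \<le> D"
    and bound: "\<And>t. t \<in> {1..T} \<Longrightarrow> norm (grad t (x t)) \<le> G"
    and smooth: "\<And>t y z. t \<in> {1..T} \<Longrightarrow> y \<in> X \<Longrightarrow> z \<in> X \<Longrightarrow> norm (F t y - F t z) \<le> L * norm (y - z)"
    and pos: "1 \<le> T" "0 < D" "0 < G" "0 < L"
  shows "(\<Sum>t=1..T. grad t (x t) \<bullet> (x t - u))
     \<le> 5 * sqrt 10 * D\<^sup>2 * L + 5 * sqrt 5 * D * G / 2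
       + 5 * sqrt 2 * D * sqrt (\<Sum>t=1..T. (norm (grad t (x t) - F t (x t)))\<^sup>2)
       + 5 * D * sqrt (\<Sum>t=1..T. (norm (F t (x t) - F (t - 1) (x t)))\<^sup>2)"
proof -
  let ?g = "observed_gradient grad x"
  have g: "?g t = grad t (x t)" if "t \<in> {1..T}" for t
    using that by (simp add: observed_gradient_def)
  have "(\<Sum>t=1..T. grad t (x t) \<bullet> (x t - u)) = (\<Sum>t=1..T. ?g t \<bullet> (x t - u))"
    by (simp add: g)
  also have "\<dots> \<le> 5 / 2 * D * sqrt (10 * D\<^sup>2 * L\<^sup>2 + 4 * G\<^sup>2 + (\<Sum>t=1..T. (norm (?g t - ?g (t - 1)))\<^sup>2))
             - sqrt (10 * D\<^sup>2 * L\<^sup>2) / (4 * D) * (\<Sum>t=2..T. (norm (x t - x (t - 1)))\<^sup>2)"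
    using pos by (intro optimistic_omd_regret[OF omd X x1 u diameter bound]) auto
  also have "\<dots> \<le> 5 * sqrt 10 * D\<^sup>2 * L + 5 * sqrt 5 * D * G / 2
       + 5 * sqrt 2 * D * sqrt (\<Sum>t=1..T. (norm (?g t - F t (x t)))\<^sup>2)
       + 5 * D * sqrt (\<Sum>t=1..T. (norm (F t (x t) - F (t - 1) (x t)))\<^sup>2)"
  proof (intro regret_bound_arith pos sum_nonneg zero_le_power2)
    show "(\<Sum>t=1..T. (norm (?g t - ?g (t - 1)))\<^sup>2)
      \<le> G\<^sup>2 + 8 * (\<Sum>t=1..T. (norm (?g t - F t (x t)))\<^sup>2)
        + 4 * (\<Sum>t=1..T. (norm (F t (x t) - F (t - 1) (x t)))\<^sup>2)
        + 4 * L\<^sup>2 * (\<Sum>t=2..T. (norm (x t - x (t - 1)))\<^sup>2)"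
    proof (rule sum_gradient_change_le[OF _ _ _ smooth])
      show "x t \<in> X" if "t \<in> {1..T}" for t
        using that by (intro optimistic_omd_in_domain[OF omd X(2) x1]) auto
    qed (use bound[of 1] pos in \<open>auto simp: observed_gradient_def\<close>)
  qed
  also have "(\<Sum>t=1..T. (norm (?g t - F t (x t)))\<^sup>2) = (\<Sum>t=1..T. (norm (grad t (x t) - F t (x t)))\<^sup>2)"
    by (simp add: g)
  finally show ?thesis .
qed

section \<open>Conditional laws\<close>

text \<open>Drawing the pair of past and sample amounts to drawing the past and then the sample from
  the kernel. The first coordinate carries the sigma-algebra \<open>F\<close> rather than that of
  \<open>M\<close>, since the conditional law is known only relative to \<open>F\<close>. Rectangles
  form an intersection-stable generator, and on \<open>a \<times> b\<close> both sides are the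
  integral of \<open>measure (K \<omega>) b\<close> over \<open>a\<close>.\<close>

lemma (in prob_space) joint_law_eq_bind:
  assumes sub: "subalgebra M F" and K: "K \<in> measurable F (prob_algebra N)" and Z: "Z \<in> measurable M N"
    and law: "\<And>A. A \<in> sets N \<Longrightarrow>
       AE \<omega> in M. real_cond_exp M F (\<lambda>\<omega>. indicator A (Z \<omega>)) \<omega> = measure (K \<omega>) A"
  shows "distr M (F \<Otimes>\<^sub>M N) (\<lambda>\<omega>. (\<omega>, Z \<omega>))
    = restr_to_subalg M F \<bind> (\<lambda>\<omega>. distr (K \<omega>) (F \<Otimes>\<^sub>M N) (Pair \<omega>))" (is "?A = ?B")
proof -
  interpret F: finite_measure_subalgebra M F by unfold_locales (rule sub)
  note [measurable] = Z
  have [measurable]: "(\<lambda>\<omega>. \<omega>) \<in> measurable M F"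
    using sub by (auto simp: measurable_def subalgebra_def)
  have Ks[measurable]: "K \<in> measurable F (subprob_algebra N)" by (rule measurable_prob_algebraD[OF K])
  have J: "(\<lambda>\<omega>. distr (K \<omega>) (F \<Otimes>\<^sub>M N) (Pair \<omega>)) \<in> measurable F (subprob_algebra (F \<Otimes>\<^sub>M N))"
    by (rule measurable_distr2[OF _ Ks]) simp
  hence J': "(\<lambda>\<omega>. distr (K \<omega>) (F \<Otimes>\<^sub>M N) (Pair \<omega>))
      \<in> measurable (restr_to_subalg M F) (subprob_algebra (F \<Otimes>\<^sub>M N))"
    by (simp add: measurable_cong_sets[OF sets_restr_to_subalg[OF sub] refl])
  have spF: "space F = space M" using sub by (simp add: subalgebra_def)
  have ne: "space (restr_to_subalg M F) \<noteq> {}" by (simp add: space_restr_to_subalg not_empty)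
  show ?thesis
  proof (rule measure_eqI_generator_eq[OF Int_stable_pair_measure_generator[of F N], where A="\<lambda>_. space F \<times> space N"])
    show "{a \<times> b |a b. a \<in> sets F \<and> b \<in> sets N} \<subseteq> Pow (space F \<times> space N)"
      by (rule pair_measure_closed)
    show "sets ?A = sigma_sets (space F \<times> space N) {a \<times> b |a b. a \<in> sets F \<and> b \<in> sets N}"
      by (simp add: sets_pair_measure)
    show "sets ?B = sigma_sets (space F \<times> space N) {a \<times> b |a b. a \<in> sets F \<and> b \<in> sets N}"
      by (simp add: sets_bind_measurable[OF J' ne] sets_pair_measure)
    show "emeasure ?A (space F \<times> space N) \<noteq> \<infinity>" for i :: nat
      by (subst emeasure_distr) (auto simp: emeasure_eq_measure)
    show "range (\<lambda>_::nat. space F \<times> space N) \<subseteq> {a \<times> b |a b. a \<in> sets F \<and> b \<in> sets N}"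
      by blast
    show "(\<Union>i::nat. space F \<times> space N) = space F \<times> space N" by simp
    fix R assume "R \<in> {a \<times> b |a b. a \<in> sets F \<and> b \<in> sets N}"
    then obtain a b where R: "R = a \<times> b" and a[measurable]: "a \<in> sets F" and b[measurable]: "b \<in> sets N"
      by auto
    have aM[measurable]: "a \<in> sets M" using a sub by (auto simp: subalgebra_def)
    have RS: "R \<in> sets (F \<Otimes>\<^sub>M N)" unfolding R by simp
    have "emeasure ?A R = emeasure M {\<omega> \<in> space M. \<omega> \<in> a \<and> Z \<omega> \<in> b}"
      using RS by (subst emeasure_distr) (auto simp: R intro!: arg_cong[where f="emeasure M"])
    also have "\<dots> = ennreal (\<integral>\<omega>. indicator a \<omega> * indicator b (Z \<omega>) \<partial>M)"
    proof -
      have "(\<integral>\<omega>. indicator a \<omega> * indicator b (Z \<omega>) \<partial>M)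
          = (\<integral>\<omega>. indicator {\<omega> \<in> space M. \<omega> \<in> a \<and> Z \<omega> \<in> b} \<omega> \<partial>M :: real)"
        by (intro Bochner_Integration.integral_cong) (auto simp: indicator_def)
      also have "\<dots> = measure M {\<omega> \<in> space M. \<omega> \<in> a \<and> Z \<omega> \<in> b}" by simp
      finally show ?thesis by (simp add: emeasure_eq_measure)
    qed
    \<comment> \<open>Because \<open>a\<close> belongs to \<open>F\<close>, its indicator is an
      admissible test function for the conditional expectation.\<close>
    also have "(\<integral>\<omega>. indicator a \<omega> * indicator b (Z \<omega>) \<partial>M :: real)
        = (\<integral>\<omega>. indicator a \<omega> * real_cond_exp M F (\<lambda>\<omega>. indicator b (Z \<omega>)) \<omega> \<partial>M)"
    proof (rule F.real_cond_exp_intg(2)[symmetric])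
      show "integrable M (\<lambda>\<omega>. indicator a \<omega> * indicator b (Z \<omega>) :: real)"
        by (rule integrable_const_bound[where B=1]) (auto simp: indicator_def)
    qed auto
    also have "\<dots> = (\<integral>\<omega>. indicator a \<omega> * measure (K \<omega>) b \<partial>M)"
    proof (rule integral_cong_AE)
      have "(\<lambda>\<omega>. measure (K \<omega>) b) \<in> borel_measurable F" by measurable
      thus "(\<lambda>\<omega>. indicator a \<omega> * measure (K \<omega>) b) \<in> borel_measurable M"
        by (intro borel_measurable_times) (auto intro: measurable_from_subalg[OF sub])
      show "(\<lambda>\<omega>. indicator a \<omega> * real_cond_exp M F (\<lambda>\<omega>. indicator b (Z \<omega>)) \<omega>) \<in> borel_measurable M"
        by (intro borel_measurable_times) (auto intro: measurable_from_subalg[OF sub])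
    qed (use law[OF b] in auto)
    also have "ennreal \<dots> = (\<integral>\<^sup>+\<omega>. ennreal (indicator a \<omega> * measure (K \<omega>) b) \<partial>M)"
    proof (rule nn_integral_eq_integral[symmetric])
      have m: "(\<lambda>\<omega>. measure (K \<omega>) b) \<in> borel_measurable F" by measurable
      have "measure (K \<omega>) b \<le> 1" if "\<omega> \<in> space M" for \<omega>
        using measurable_space[OF K, of \<omega>] that spF
        by (auto simp: space_prob_algebra intro!: prob_space.prob_le_1)
      thus "integrable M (\<lambda>\<omega>. indicator a \<omega> * measure (K \<omega>) b)"
        using measurable_from_subalg[OF sub m]
        by (intro integrable_const_bound[where B=1]) (auto simp: indicator_def intro!: AE_I2)
    qed auto
    also have "\<dots> = (\<integral>\<^sup>+\<omega>. emeasure (distr (K \<omega>) (F \<Otimes>\<^sub>M N) (Pair \<omega>)) R \<partial>M)"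
    proof (rule nn_integral_cong)
      fix \<omega> assume w: "\<omega> \<in> space M"
      have Kw: "sets (K \<omega>) = sets N" "prob_space (K \<omega>)"
        using measurable_space[OF K, of \<omega>] w spF by (auto simp: space_prob_algebra)
      interpret Kw: prob_space "K \<omega>" by (rule Kw)
      have Pm: "Pair \<omega> \<in> measurable (K \<omega>) (F \<Otimes>\<^sub>M N)"
        using w spF by (simp add: measurable_cong_sets[OF Kw(1) refl])
      have "emeasure (distr (K \<omega>) (F \<Otimes>\<^sub>M N) (Pair \<omega>)) R = emeasure (K \<omega>) (Pair \<omega> -` R \<inter> space (K \<omega>))"
        by (rule emeasure_distr[OF Pm RS])
      also have "Pair \<omega> -` R \<inter> space (K \<omega>) = (if \<omega> \<in> a then b else {})"
        using sets.sets_into_space[OF b] sets_eq_imp_space_eq[OF Kw(1)] by (auto simp: R)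
      finally show "ennreal (indicator a \<omega> * measure (K \<omega>) b)
          = emeasure (distr (K \<omega>) (F \<Otimes>\<^sub>M N) (Pair \<omega>)) R"
        by (simp add: Kw.emeasure_eq_measure)
    qed
    also have "\<dots> = (\<integral>\<^sup>+\<omega>. emeasure (distr (K \<omega>) (F \<Otimes>\<^sub>M N) (Pair \<omega>)) R \<partial>restr_to_subalg M F)"
      by (rule nn_integral_subalgebra2[OF sub, symmetric]) (rule measurable_compose[OF J measurable_emeasure_subprob_algebra[OF RS]])
    also have "\<dots> = emeasure ?B R" by (rule emeasure_bind[OF ne J' RS, symmetric])
    finally show "emeasure ?A R = emeasure ?B R" .
  qed
qed

lemma integral_kernel_eq:
  fixes h :: "'a \<times> 'b \<Rightarrow> 'c::{banach, second_countable_topology}"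
  assumes "h \<in> borel_measurable (F \<Otimes>\<^sub>M N)" "K \<in> measurable F (subprob_algebra N)" "\<omega> \<in> space F"
  shows "(\<integral>p. h p \<partial>distr (K \<omega>) (F \<Otimes>\<^sub>M N) (Pair \<omega>)) = (\<integral>\<phi>. h (\<omega>, \<phi>) \<partial>K \<omega>)"
proof (rule integral_distr[OF _ assms(1)])
  show "Pair \<omega> \<in> measurable (K \<omega>) (F \<Otimes>\<^sub>M N)"
    using assms(3) by (simp add: measurable_cong_sets[OF sets_kernel[OF assms(2,3)] refl])
qed

text \<open>Here both the integrand and the measure vary with \<open>\<omega>\<close>. Pushing
  \<open>K \<omega>\<close> forward along \<open>Pair \<omega>\<close> leaves a fixed integrand on
  the product space and moves all the dependence into a measurable kernel.\<close>

lemma borel_measurable_integral_kernel: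
  fixes h :: "'a \<times> 'b \<Rightarrow> 'c::{banach, second_countable_topology}"
  assumes h: "h \<in> borel_measurable (F \<Otimes>\<^sub>M N)" and K: "K \<in> measurable F (subprob_algebra N)"
  shows "(\<lambda>\<omega>. \<integral>\<phi>. h (\<omega>, \<phi>) \<partial>K \<omega>) \<in> borel_measurable F"
proof -
  have J: "(\<lambda>\<omega>. distr (K \<omega>) (F \<Otimes>\<^sub>M N) (Pair \<omega>)) \<in> measurable F (subprob_algebra (F \<Otimes>\<^sub>M N))"
    by (rule measurable_distr2[OF _ K]) simp
  have "(\<lambda>\<omega>. \<integral>p. h p \<partial>distr (K \<omega>) (F \<Otimes>\<^sub>M N) (Pair \<omega>)) \<in> borel_measurable F"
    by (rule measurable_compose[OF J integral_measurable_subprob_algebra[OF h]])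
  thus ?thesis by (subst (asm) measurable_cong[OF integral_kernel_eq[OF h K]]) auto
qed

section \<open>Replacing a sample by its conditional law\<close>

context prob_space
begin

context
  fixes F :: "'a measure" and K :: "'a \<Rightarrow> 'b measure" and N :: "'b measure" and Z :: "'a \<Rightarrow> 'b"
  assumes sub: "subalgebra M F" and K: "K \<in> measurable F (prob_algebra N)" and Z: "Z \<in> measurable M N"
    and law: "\<And>A. A \<in> sets N \<Longrightarrow>
       AE \<omega> in M. real_cond_exp M F (\<lambda>\<omega>. indicator A (Z \<omega>)) \<omega> = measure (K \<omega>) A"
begin

private lemma
  shows space_F: "space F = space M"
    and K_subprob: "K \<in> measurable F (subprob_algebra N)"
    and pair_measurable: "(\<lambda>\<omega>. (\<omega>, Z \<omega>)) \<in> measurable M (F \<Otimes>\<^sub>M N)"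
    and kernel_measurable: "(\<lambda>\<omega>. distr (K \<omega>) (F \<Otimes>\<^sub>M N) (Pair \<omega>))
      \<in> measurable (restr_to_subalg M F) (subprob_algebra (F \<Otimes>\<^sub>M N))"
proof -
  show "space F = space M" using sub by (simp add: subalgebra_def)
  show Ks: "K \<in> measurable F (subprob_algebra N)" by (rule measurable_prob_algebraD[OF K])
  have "(\<lambda>\<omega>. \<omega>) \<in> measurable M F" using sub by (auto simp: measurable_def subalgebra_def)
  thus "(\<lambda>\<omega>. (\<omega>, Z \<omega>)) \<in> measurable M (F \<Otimes>\<^sub>M N)" using Z by (rule measurable_Pair)
  show "(\<lambda>\<omega>. distr (K \<omega>) (F \<Otimes>\<^sub>M N) (Pair \<omega>))
      \<in> measurable (restr_to_subalg M F) (subprob_algebra (F \<Otimes>\<^sub>M N))"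
    unfolding measurable_cong_sets[OF sets_restr_to_subalg[OF sub] refl]
    by (rule measurable_distr2[OF _ Ks]) simp
qed

private lemma joint_law: "distr M (F \<Otimes>\<^sub>M N) (\<lambda>\<omega>. (\<omega>, Z \<omega>))
    = restr_to_subalg M F \<bind> (\<lambda>\<omega>. distr (K \<omega>) (F \<Otimes>\<^sub>M N) (Pair \<omega>))"
  by (rule joint_law_eq_bind[OF sub K Z law])

text \<open>The exceptional sets of the measures \<open>K \<omega>\<close> may change with
  \<open>\<omega>\<close>. Joint measurability of \<open>Q\<close> is what assembles them into a
  single null event.\<close>

lemma AE_conditional_law:
  assumes Q: "Measurable.pred (F \<Otimes>\<^sub>M N) Q"
    and AE: "\<And>\<omega>. \<omega> \<in> space M \<Longrightarrow> AE \<phi> in K \<omega>. Q (\<omega>, \<phi>)"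
  shows "AE \<omega> in M. Q (\<omega>, Z \<omega>)"
proof -
  have "AE p in distr M (F \<Otimes>\<^sub>M N) (\<lambda>\<omega>. (\<omega>, Z \<omega>)). Q p"
    unfolding joint_law AE_bind[OF kernel_measurable Q]
  proof (rule AE_I2)
    fix \<omega> assume "\<omega> \<in> space (restr_to_subalg M F)"
    hence w: "\<omega> \<in> space F" by (simp add: space_restr_to_subalg space_F)
    have "Pair \<omega> \<in> measurable (K \<omega>) (F \<Otimes>\<^sub>M N)"
      using w by (simp add: measurable_cong_sets[OF sets_kernel[OF K_subprob w] refl])
    thus "AE p in distr (K \<omega>) (F \<Otimes>\<^sub>M N) (Pair \<omega>). Q p"
      using AE[of \<omega>] w Q by (simp add: AE_distr_iff pred_def space_F)
  qed
  thus ?thesis using Q by (subst (asm) AE_distr_iff[OF pair_measurable]) (auto simp: pred_def)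
qed

text \<open>The tower property for bounded integrands, with the past frozen inside the inner
  integral. The bound is asked for almost surely under each \<open>K \<omega>\<close>, because the
  gradients of the model are bounded in that sense.\<close>

lemma
  fixes h :: "'a \<times> 'b \<Rightarrow> real"
  assumes h: "h \<in> borel_measurable (F \<Otimes>\<^sub>M N)"
    and AE: "\<And>\<omega>. \<omega> \<in> space M \<Longrightarrow> AE \<phi> in K \<omega>. \<bar>h (\<omega>, \<phi>)\<bar> \<le> B"
  shows integrable_conditional_law: "integrable M (\<lambda>\<omega>. h (\<omega>, Z \<omega>))"
    and integrable_kernel_integral: "integrable M (\<lambda>\<omega>. \<integral>\<phi>. h (\<omega>, \<phi>) \<partial>K \<omega>)"
    and integral_conditional_law:
      "(\<integral>\<omega>. h (\<omega>, Z \<omega>) \<partial>M) = (\<integral>\<omega>. (\<integral>\<phi>. h (\<omega>, \<phi>) \<partial>K \<omega>) \<partial>M)"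
proof -
  have hZ: "(\<lambda>\<omega>. h (\<omega>, Z \<omega>)) \<in> borel_measurable M"
    by (rule measurable_compose[OF pair_measurable h])
  have Q: "Measurable.pred (F \<Otimes>\<^sub>M N) (\<lambda>p. \<bar>h p\<bar> \<le> B)" using h by measurable
  have bd: "AE \<omega> in M. \<bar>h (\<omega>, Z \<omega>)\<bar> \<le> B" by (rule AE_conditional_law[OF Q AE])
  show "integrable M (\<lambda>\<omega>. h (\<omega>, Z \<omega>))"
    using hZ bd by (intro integrable_const_bound[where B=B]) auto
  have m: "(\<lambda>\<omega>. \<integral>\<phi>. h (\<omega>, \<phi>) \<partial>K \<omega>) \<in> borel_measurable F"
    by (rule borel_measurable_integral_kernel[OF h K_subprob])
  have Kw: "prob_space (K \<omega>)" "sets (K \<omega>) = sets N" if "\<omega> \<in> space M" for \<omega>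
    using measurable_space[OF K, of \<omega>] that by (auto simp: space_prob_algebra space_F)
  have hw: "(\<lambda>\<phi>. h (\<omega>, \<phi>)) \<in> borel_measurable (K \<omega>)" if w: "\<omega> \<in> space M" for \<omega>
    using measurable_compose[OF measurable_Pair1' h, of \<omega>] w
    by (simp add: space_F measurable_cong_sets[OF Kw(2)[OF w] refl])
  have "\<bar>\<integral>\<phi>. h (\<omega>, \<phi>) \<partial>K \<omega>\<bar> \<le> B" if w: "\<omega> \<in> space M" for \<omega>
  proof -
    interpret Kw: prob_space "K \<omega>" by (rule Kw[OF w])
    have "integrable (K \<omega>) (\<lambda>\<phi>. h (\<omega>, \<phi>))"
      using hw[OF w] AE[OF w] by (intro Kw.integrable_const_bound[where B=B]) auto
    hence "norm (\<integral>\<phi>. h (\<omega>, \<phi>) \<partial>K \<omega>) \<le> (\<integral>\<phi>. norm (h (\<omega>, \<phi>)) \<partial>K \<omega>)" by simp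
    also have "\<dots> \<le> B"
      using \<open>integrable (K \<omega>) _\<close> AE[OF w] by (intro Kw.integral_le_const) auto
    finally show ?thesis by simp
  qed
  thus "integrable M (\<lambda>\<omega>. \<integral>\<phi>. h (\<omega>, \<phi>) \<partial>K \<omega>)"
    using measurable_from_subalg[OF sub m] by (intro integrable_const_bound[where B=B]) (auto intro!: AE_I2)
  txt \<open>The library lemma on integrals over \<open>\<bind>\<close> needs a bound that holds everywhere.\<close>
  define h' where "h' p = max (- \<bar>B\<bar>) (min \<bar>B\<bar> (h p))" for p
  have h'[measurable]: "h' \<in> borel_measurable (F \<Otimes>\<^sub>M N)" unfolding h'_def using h by measurable
  have h'_eq: "h' p = h p" if "\<bar>h p\<bar> \<le> B" for p using that by (auto simp: h'_def)
  have R: "finite_measure (restr_to_subalg M F)"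
    using finite_measure_restr_to_subalg[OF sub] emeasure_space_1 by (simp add: finite_measure_axioms)
  have "(\<integral>\<omega>. h (\<omega>, Z \<omega>) \<partial>M) = (\<integral>\<omega>. h' (\<omega>, Z \<omega>) \<partial>M)"
    using bd hZ measurable_compose[OF pair_measurable h']
    by (intro integral_cong_AE) (auto elim!: eventually_mono simp: h'_eq)
  also have "\<dots> = (\<integral>p. h' p \<partial>distr M (F \<Otimes>\<^sub>M N) (\<lambda>\<omega>. (\<omega>, Z \<omega>)))"
    by (rule integral_distr[OF pair_measurable h', symmetric])
  also have "\<dots> = (\<integral>\<omega>. \<integral>p. h' p \<partial>distr (K \<omega>) (F \<Otimes>\<^sub>M N) (Pair \<omega>) \<partial>restr_to_subalg M F)"
    unfolding joint_law
  proof (rule integral_bind[OF h' _ kernel_measurable R])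
    show "\<bar>h' p\<bar> \<le> \<bar>B\<bar>" for p by (auto simp: h'_def)
    show "AE \<omega> in restr_to_subalg M F. emeasure (distr (K \<omega>) (F \<Otimes>\<^sub>M N) (Pair \<omega>))
        (space (distr (K \<omega>) (F \<Otimes>\<^sub>M N) (Pair \<omega>))) \<le> ennreal 1"
    proof (rule AE_I2)
      fix \<omega> assume "\<omega> \<in> space (restr_to_subalg M F)"
      from measurable_space[OF kernel_measurable this]
      show "emeasure (distr (K \<omega>) (F \<Otimes>\<^sub>M N) (Pair \<omega>))
        (space (distr (K \<omega>) (F \<Otimes>\<^sub>M N) (Pair \<omega>))) \<le> ennreal 1"
        using subprob_space.emeasure_space_le_1[of "distr (K \<omega>) (F \<Otimes>\<^sub>M N) (Pair \<omega>)"]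
        by (simp add: space_subprob_algebra)
    qed
  qed
  also have "\<dots> = (\<integral>\<omega>. \<integral>\<phi>. h' (\<omega>, \<phi>) \<partial>K \<omega> \<partial>restr_to_subalg M F)"
    by (intro Bochner_Integration.integral_cong refl integral_kernel_eq[OF h' K_subprob])
      (simp add: space_restr_to_subalg space_F)
  also have "\<dots> = (\<integral>\<omega>. \<integral>\<phi>. h' (\<omega>, \<phi>) \<partial>K \<omega> \<partial>M)"
    by (rule integral_subalgebra2[OF sub borel_measurable_integral_kernel[OF h' K_subprob]])
  also have "\<dots> = (\<integral>\<omega>. \<integral>\<phi>. h (\<omega>, \<phi>) \<partial>K \<omega> \<partial>M)"
  proof (rule Bochner_Integration.integral_cong[OF refl])
    fix \<omega> assume w: "\<omega> \<in> space M"
    have "(\<lambda>\<phi>. h' (\<omega>, \<phi>)) \<in> borel_measurable (K \<omega>)"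
      using measurable_compose[OF measurable_Pair1' h', of \<omega>] w
      by (simp add: space_F measurable_cong_sets[OF Kw(2)[OF w] refl])
    thus "(\<integral>\<phi>. h' (\<omega>, \<phi>) \<partial>K \<omega>) = (\<integral>\<phi>. h (\<omega>, \<phi>) \<partial>K \<omega>)"
      using AE[OF w] hw[OF w] by (intro integral_cong_AE) (auto elim!: eventually_mono simp: h'_eq)
  qed
  finally show "(\<integral>\<omega>. h (\<omega>, Z \<omega>) \<partial>M) = (\<integral>\<omega>. (\<integral>\<phi>. h (\<omega>, \<phi>) \<partial>K \<omega>) \<partial>M)" .
qed

end

text \<open>Jensen's inequality for the square root is the nonnegativity of the variance of
  \<open>sqrt (Y \<omega>)\<close>. Integrability comes from
  \<open>sqrt y \<le> 1 + y\<close>.\<close>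

lemma expectation_sqrt_le:
  assumes "integrable M Y" "\<And>\<omega>. \<omega> \<in> space M \<Longrightarrow> 0 \<le> Y \<omega>"
  shows "integrable M (\<lambda>\<omega>. sqrt (Y \<omega>))" "expectation (\<lambda>\<omega>. sqrt (Y \<omega>)) \<le> sqrt (expectation Y)"
proof -
  have le: "sqrt y \<le> 1 + y" if "0 \<le> y" for y :: real
    using that by (intro real_le_lsqrt) (auto simp: power2_eq_square algebra_simps)
  show i: "integrable M (\<lambda>\<omega>. sqrt (Y \<omega>))"
  proof (rule Bochner_Integration.integrable_bound)
    show "integrable M (\<lambda>\<omega>. 1 + Y \<omega>)" using assms(1) by simp
    show "AE \<omega> in M. norm (sqrt (Y \<omega>)) \<le> norm (1 + Y \<omega>)"
      using le assms(2) by (intro AE_I2) simp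
  qed (use assms(1) in measurable)
  have eq: "(sqrt (Y \<omega>))\<^sup>2 = Y \<omega>" if "\<omega> \<in> space M" for \<omega> using assms(2)[OF that] by simp
  have sq: "integrable M (\<lambda>\<omega>. (sqrt (Y \<omega>))\<^sup>2)"
    by (subst Bochner_Integration.integrable_cong[OF refl eq]) (use assms(1) in auto)
  have "0 \<le> variance (\<lambda>\<omega>. sqrt (Y \<omega>))" by (rule variance_positive)
  also have "\<dots> = expectation Y - (expectation (\<lambda>\<omega>. sqrt (Y \<omega>)))\<^sup>2"
    unfolding variance_eq[OF i sq] by (simp add: eq cong: Bochner_Integration.integral_cong)
  finally show "expectation (\<lambda>\<omega>. sqrt (Y \<omega>)) \<le> sqrt (expectation Y)"
    by (intro real_le_rsqrt) simp
qed

end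

text \<open>The point \<open>x\<close> may lie on the boundary and \<open>S\<close> may have empty
  interior, so \<open>f'\<close> need not be unique. Only its value at \<open>y - x\<close> matters,
  and that is the one-sided derivative along the segment from \<open>x\<close> to \<open>y\<close>,
  whose difference quotients are at most \<open>f y - f x\<close> by convexity.\<close>

lemma convex_on_tangent_within:
  fixes f :: "'a::real_normed_vector \<Rightarrow> real"
  assumes f: "convex_on S f" and S: "convex S" and x: "x \<in> S" and y: "y \<in> S"
    and f': "(f has_derivative f') (at x within S)"
  shows "f x + f' (y - x) \<le> f y"
proof -
  define \<gamma> where "\<gamma> s = x + s *\<^sub>R (y - x)" for s :: real
  have \<gamma>: "\<gamma> s = (1 - s) *\<^sub>R x + s *\<^sub>R y" for s by (simp add: \<gamma>_def algebra_simps)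
  have sub: "\<gamma> ` {0..1} \<subseteq> S" using S x y by (auto simp: \<gamma> convex_def)
  have d\<gamma>: "(\<gamma> has_derivative (\<lambda>s. s *\<^sub>R (y - x))) (at 0 within {0..1})"
    unfolding \<gamma>_def by (auto intro!: derivative_eq_intros)
  have "(f has_derivative f') (at (\<gamma> 0) within \<gamma> ` {0..1})"
    using has_derivative_subset[OF f' sub] by (simp add: \<gamma>_def)
  from has_derivative_in_compose[OF d\<gamma> this]
  have "((\<lambda>s. f (\<gamma> s)) has_derivative (\<lambda>s. f' (s *\<^sub>R (y - x)))) (at 0 within {0..1})" .
  moreover have "f' (s *\<^sub>R (y - x)) = f' (y - x) * s" for s
    using linear_cmul[OF has_derivative_linear[OF f']] by simp
  ultimately have "((\<lambda>s. f (\<gamma> s)) has_field_derivative f' (y - x)) (at 0 within {0..1})"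
    by (simp add: has_field_derivative_def)
  hence "((\<lambda>s. (f (\<gamma> s) - f x) / s) \<longlongrightarrow> f' (y - x)) (at 0 within {0..1})"
    by (simp add: has_field_derivative_iff \<gamma>_def)
  moreover have "\<forall>\<^sub>F s in at 0 within {0..1}. (f (\<gamma> s) - f x) / s \<le> f y - f x"
    unfolding eventually_at_filter
  proof (intro always_eventually allI impI)
    fix s :: real assume "s \<noteq> 0" "s \<in> {0..1}"
    hence "f (\<gamma> s) \<le> (1 - s) * f x + s * f y" "0 < s"
      unfolding \<gamma> using convex_onD[OF f, of s x y] x y by auto
    thus "(f (\<gamma> s) - f x) / s \<le> f y - f x" by (simp add: field_simps)
  qed
  ultimately have "f' (y - x) \<le> f y - f x"
    by (rule tendsto_upperbound) (simp add: at_within_Icc_at_right)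
  thus ?thesis by simp
qed

section \<open>The stochastically extended adversary\<close>

locale sea_omd = sea_model M H N X nabla P f T
  for M :: "'w measure" and H N and X :: "(real ^ 'n) set" and nabla P f T +
  fixes x xhat :: "nat \<Rightarrow> 'w \<Rightarrow> real ^ 'n" and x1 :: "real ^ 'n" and D G L :: real
  assumes G: "0 < G" and D: "0 < D" and L: "0 < L"
    and bounded_gradients:
      "\<And>t \<omega>. t \<in> {1..T} \<Longrightarrow> \<omega> \<in> space M \<Longrightarrow> AE \<phi> in P t \<omega>. \<forall>y\<in>X. norm (nabla \<phi> y) \<le> G"
    and diameter: "\<And>y z. y \<in> X \<Longrightarrow> z \<in> X \<Longrightarrow> norm (y - z) \<le> D"
    and smooth:
      "\<And>t \<omega> y z. t \<in> {1..T} \<Longrightarrow> \<omega> \<in> space M \<Longrightarrow> y \<in> X \<Longrightarrow> z \<in> X \<Longrightarrow>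
         norm (expected_gradient nabla (P t \<omega>) y - expected_gradient nabla (P t \<omega>) z)
           \<le> L * norm (y - z)"
    and convex:
      "\<And>t \<omega>. t \<in> {1..T} \<Longrightarrow> \<omega> \<in> space M \<Longrightarrow> convex_on X (expected_function (P t \<omega>))"
    and start: "x1 \<in> X"
    and algorithm:
      "\<And>\<omega>. \<omega> \<in> space M \<Longrightarrow>
         optimistic_omd X
           (adaptive_step D G (10 * D\<^sup>2 * L\<^sup>2)
              (observed_gradient (\<lambda>t. nabla (f t \<omega>)) (\<lambda>t. x t \<omega>)))
           T x1 (\<lambda>t. nabla (f t \<omega>)) (\<lambda>t. x t \<omega>) (\<lambda>t. xhat t \<omega>)"
begin

abbreviation g :: "nat \<Rightarrow> 'w \<Rightarrow> real ^ 'n" where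
  "g t \<omega> \<equiv> nabla (f t \<omega>) (x t \<omega>)"

abbreviation F :: "nat \<Rightarrow> 'w \<Rightarrow> real ^ 'n \<Rightarrow> real ^ 'n" where
  "F \<equiv> round_gradient nabla P"

section \<open>Measurability and adaptedness of the iterates\<close>

lemma space_H: "space (H t) = space M"
  using history[of t] by (simp add: subalgebra_def)

lemma measurable_H_M: "h \<in> measurable (H t) B \<Longrightarrow> h \<in> measurable M B"
  by (rule measurable_from_subalg[OF history])

lemma measurable_H_mono: "h \<in> measurable (H s) B \<Longrightarrow> s \<le> t \<Longrightarrow> h \<in> measurable (H t) B"
  using sets_F_mono[of s t] by (auto simp: measurable_def space_H)

lemma sample_M: "t \<in> {1..T} \<Longrightarrow> f t \<in> measurable M N"
  by (rule measurable_H_M[OF sample])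

lemma distribution_subprob: "t \<in> {1..T} \<Longrightarrow> P t \<in> measurable (H t) (subprob_algebra N)"
  by (rule measurable_prob_algebraD[OF distribution])

lemma
  assumes "t \<in> {1..T}" "\<omega> \<in> space M"
  shows prob_space_P: "prob_space (P t \<omega>)" and sets_P: "sets (P t \<omega>) = sets N"
    and space_P: "space (P t \<omega>) = space N"
proof -
  have "P t \<omega> \<in> space (prob_algebra N)"
    using measurable_space[OF distribution] assms by (simp add: space_H)
  thus "prob_space (P t \<omega>)" and "sets (P t \<omega>) = sets N"
    by (auto simp: space_prob_algebra)
  thus "space (P t \<omega>) = space N" by (metis sets_eq_imp_space_eq)
qed

lemma gradient_at_measurable: "y \<in> X \<Longrightarrow> (\<lambda>\<phi>. nabla \<phi> y) \<in> borel_measurable N"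
  using measurable_compose[OF measurable_Pair2'[of y "restrict_space borel X" N] measurable_gradient]
  by (simp add: space_restrict_space)

lemma value_at_measurable: "y \<in> X \<Longrightarrow> (\<lambda>\<phi>. \<phi> y) \<in> borel_measurable N"
  using measurable_compose[OF measurable_Pair2'[of y "restrict_space borel X" N] measurable_value]
  by (simp add: space_restrict_space)

lemma x_in: "t \<in> {1..Suc T} \<Longrightarrow> \<omega> \<in> space M \<Longrightarrow> x t \<omega> \<in> X"
  by (rule optimistic_omd_in_domain(1)[OF algorithm domain(2) start])

lemma adapted_gradient:
  assumes "t \<in> {1..T}" and x: "x t \<in> borel_measurable (H t)"
  shows "g t \<in> borel_measurable (H (Suc t))"
proof -
  have "x t \<in> measurable (H (Suc t)) (restrict_space borel X)"
    using measurable_H_mono[OF x, of "Suc t"] x_in[of t] assms(1)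
    by (intro measurable_restrict_space2) (auto simp: space_H)
  hence "(\<lambda>\<omega>. (f t \<omega>, x t \<omega>)) \<in> measurable (H (Suc t)) (N \<Otimes>\<^sub>M restrict_space borel X)"
    by (intro measurable_Pair sample assms)
  from measurable_compose[OF this measurable_gradient] show ?thesis by simp
qed

text \<open>This makes the iterate of round \<open>t\<close> a constant when one conditions on
  \<open>H t\<close>. Strong induction is needed because a step size sums over the gradients of all
  earlier rounds.\<close>

lemma adapted:
  assumes "t \<in> {1..Suc T}"
  shows "x t \<in> borel_measurable (H t) \<and> xhat t \<in> borel_measurable (H t)"
  using assms
proof (induction t rule: less_induct)
  case (less t)
  show ?case
  proof (cases "t = 1")
    case True
    have "x 1 \<omega> = x1" "xhat 1 \<omega> = x1" if "\<omega> \<in> space (H 1)" for \<omega>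
      using algorithm[of \<omega>] that by (auto simp: optimistic_omd_def space_H)
    hence "x 1 \<in> borel_measurable (H 1) \<longleftrightarrow> (\<lambda>_. x1) \<in> borel_measurable (H 1)"
      "xhat 1 \<in> borel_measurable (H 1) \<longleftrightarrow> (\<lambda>_. x1) \<in> borel_measurable (H 1)"
      by (intro measurable_cong; simp)+
    thus ?thesis unfolding True by simp
  next
    case False
    define s where "s = t - 1"
    have s: "t = s + 1" "s \<in> {1..T}" using False less.prems by (auto simp: s_def)
    define og where "og r \<omega> = observed_gradient (\<lambda>t. nabla (f t \<omega>)) (\<lambda>t. x t \<omega>) r" for r \<omega>
    define \<eta> where "\<eta> r \<omega> = adaptive_step D G (10 * D\<^sup>2 * L\<^sup>2) (\<lambda>r. og r \<omega>) r" for r \<omega>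
    have gm: "g r \<in> borel_measurable (H t)" if "r \<in> {1..s}" for r
      using that s less.IH[of r] by (intro measurable_H_mono[OF adapted_gradient]) auto
    have om[measurable]: "og r \<in> borel_measurable (H t)" if "r \<le> s" for r
      using that gm[of r] by (cases "r = 0") (auto simp: og_def[abs_def] observed_gradient_def)
    \<comment> \<open>Round \<open>t\<close> uses the step sizes \<open>s\<close> and
      \<open>Suc s\<close>. The later one involves gradients only up to round
      \<open>s = t - 1\<close>, hence is known at time \<open>t\<close>.\<close>
    have \<eta>m: "\<eta> r \<in> borel_measurable (H t)" if "r \<in> {s, Suc s}" for r
    proof -
      have "(\<lambda>\<omega>. \<Sum>i=1..r - 1. (norm (og i \<omega> - og (i - 1) \<omega>))\<^sup>2) \<in> borel_measurable (H t)"
        using that by (intro borel_measurable_sum borel_measurable_power borel_measurable_norm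
          borel_measurable_diff om) auto
      thus ?thesis unfolding \<eta>_def[abs_def] adaptive_step_def by measurable
    qed
    have proj: "(\<lambda>\<omega>. closest_point X (a \<omega> - \<eta> r \<omega> *\<^sub>R g s \<omega>)) \<in> borel_measurable (H t)"
      if "a \<in> borel_measurable (H t)" "r \<in> {s, Suc s}" for a r
    proof (rule borel_measurable_continuous_on[where f="closest_point X"])
      show "continuous_on UNIV (closest_point X)"
        using domain by (intro continuous_on_closest_point)
      show "(\<lambda>\<omega>. a \<omega> - \<eta> r \<omega> *\<^sub>R g s \<omega>) \<in> borel_measurable (H t)"
        using that s \<eta>m[of r] gm[of s] by (intro borel_measurable_diff borel_measurable_scaleR) auto
    qed
    have "xhat s \<in> borel_measurable (H t)"
      using less.IH[of s] s by (auto intro: measurable_H_mono)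
    from proj[OF this, of s]
    have 1: "(\<lambda>\<omega>. closest_point X (xhat s \<omega> - \<eta> s \<omega> *\<^sub>R g s \<omega>)) \<in> borel_measurable (H t)" by simp
    have eq: "xhat t \<omega> = closest_point X (xhat s \<omega> - \<eta> s \<omega> *\<^sub>R g s \<omega>)"
      "x t \<omega> = closest_point X (xhat t \<omega> - \<eta> (Suc s) \<omega> *\<^sub>R g s \<omega>)" if "\<omega> \<in> space (H t)" for \<omega>
      using algorithm[of \<omega>] that s(2)
      by (simp_all add: optimistic_omd_def s(1) \<eta>_def og_def space_H)
    have xh: "xhat t \<in> borel_measurable (H t)" using 1 by (simp add: eq(1) cong: measurable_cong)
    from proj[OF this, of "Suc s"] have "x t \<in> borel_measurable (H t)"
      by (simp add: eq(2) cong: measurable_cong)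
    with xh show ?thesis by simp
  qed
qed

lemma play_pair_measurable:
  assumes "t \<in> {1..T}"
  shows "(\<lambda>p. (snd p, x t (fst p))) \<in> measurable (H t \<Otimes>\<^sub>M N) (N \<Otimes>\<^sub>M restrict_space borel X)"
proof -
  have "x t \<in> measurable (H t) (restrict_space borel X)"
    using adapted[of t] x_in[of t] assms by (intro measurable_restrict_space2) (auto simp: space_H)
  thus ?thesis by (intro measurable_Pair measurable_snd measurable_compose[OF measurable_fst])
qed

lemma gradient_play_measurable:
  "t \<in> {1..T} \<Longrightarrow> (\<lambda>p. nabla (snd p) (x t (fst p))) \<in> borel_measurable (H t \<Otimes>\<^sub>M N)"
  using measurable_compose[OF play_pair_measurable measurable_gradient] by simp

lemma value_play_measurable:
  "t \<in> {1..T} \<Longrightarrow> (\<lambda>p. (snd p) (x t (fst p))) \<in> borel_measurable (H t \<Otimes>\<^sub>M N)"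
  using measurable_compose[OF play_pair_measurable measurable_value] by simp

lemma x_measurable_pair: "t \<in> {1..T} \<Longrightarrow> (\<lambda>p. x t (fst p)) \<in> borel_measurable (H t \<Otimes>\<^sub>M N)"
  using adapted[of t] by (intro measurable_compose[OF measurable_fst]) auto

section \<open>Bounds on the sampled gradients and their variance\<close>

lemma AE_gradient_bound:
  "t \<in> {1..T} \<Longrightarrow> \<omega> \<in> space M \<Longrightarrow> y \<in> X \<Longrightarrow> AE \<phi> in P t \<omega>. norm (nabla \<phi> y) \<le> G"
  using bounded_gradients[of t \<omega>] by (auto elim: eventually_mono)

lemma gradient_integrable:
  assumes t: "t \<in> {1..T}" "\<omega> \<in> space M" and y: "y \<in> X"
  shows "integrable (P t \<omega>) (\<lambda>\<phi>. nabla \<phi> y)"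
proof -
  interpret Pt: prob_space "P t \<omega>" by (rule prob_space_P[OF t])
  show ?thesis
    using gradient_at_measurable[OF y] AE_gradient_bound[OF t y]
    by (intro Pt.integrable_const_bound[where B=G]) (simp_all add: measurable_cong_sets[OF sets_P[OF t] refl])
qed

lemma norm_expected_gradient_le:
  assumes t: "t \<in> {1..T}" "\<omega> \<in> space M" and y: "y \<in> X"
  shows "norm (expected_gradient nabla (P t \<omega>) y) \<le> G"
proof -
  interpret Pt: prob_space "P t \<omega>" by (rule prob_space_P[OF t])
  have "norm (\<integral>\<phi>. nabla \<phi> y \<partial>P t \<omega>) \<le> (\<integral>\<phi>. norm (nabla \<phi> y) \<partial>P t \<omega>)" by simp
  also have "\<dots> \<le> G"
    using gradient_integrable[OF t y] AE_gradient_bound[OF t y] by (intro Pt.integral_le_const) auto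
  finally show ?thesis by (simp add: expected_gradient_def)
qed

lemma AE_deviation_le:
  assumes t: "t \<in> {1..T}" "\<omega> \<in> space M" and y: "y \<in> X"
  shows "AE \<phi> in P t \<omega>. \<bar>(norm (nabla \<phi> y - expected_gradient nabla (P t \<omega>) y))\<^sup>2\<bar> \<le> 4 * G\<^sup>2"
  using AE_gradient_bound[OF t y]
proof eventually_elim
  case (elim \<phi>)
  hence "norm (nabla \<phi> y - expected_gradient nabla (P t \<omega>) y) \<le> 2 * G"
    using norm_triangle_ineq4[of "nabla \<phi> y" "expected_gradient nabla (P t \<omega>) y"]
      norm_expected_gradient_le[OF t y] by linarith
  hence "(norm (nabla \<phi> y - expected_gradient nabla (P t \<omega>) y))\<^sup>2 \<le> (2 * G)\<^sup>2"
    by (intro power_mono) auto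
  thus ?case by simp
qed

text \<open>A real \<open>SUP\<close> is a true supremum only over a set bounded above. The bound
  \<open>4 * G\<^sup>2\<close> secures this and also makes the variance integrable.\<close>

lemma
  assumes t: "t \<in> {1..T}" "\<omega> \<in> space M"
  shows deviation_le_variance: "y \<in> X \<Longrightarrow>
      (\<integral>\<phi>. (norm (nabla \<phi> y - expected_gradient nabla (P t \<omega>) y))\<^sup>2 \<partial>P t \<omega>) \<le> gradient_variance X nabla (P t \<omega>)"
    and gradient_variance_nonneg: "0 \<le> gradient_variance X nabla (P t \<omega>)"
    and gradient_variance_le: "gradient_variance X nabla (P t \<omega>) \<le> 4 * G\<^sup>2"
proof -
  interpret Pt: prob_space "P t \<omega>" by (rule prob_space_P[OF t])
  let ?I = "\<lambda>y. \<integral>\<phi>. (norm (nabla \<phi> y - expected_gradient nabla (P t \<omega>) y))\<^sup>2 \<partial>P t \<omega>"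
  have le: "?I y \<le> 4 * G\<^sup>2" if y: "y \<in> X" for y
  proof (rule Pt.integral_le_const)
    have "(\<lambda>\<phi>. nabla \<phi> y) \<in> borel_measurable (P t \<omega>)"
      using gradient_at_measurable[OF y] by (simp add: measurable_cong_sets[OF sets_P[OF t] refl])
    thus "integrable (P t \<omega>) (\<lambda>\<phi>. (norm (nabla \<phi> y - expected_gradient nabla (P t \<omega>) y))\<^sup>2)"
      using AE_deviation_le[OF t y] by (intro Pt.integrable_const_bound[where B="4 * G\<^sup>2"]) auto
    show "AE \<phi> in P t \<omega>. (norm (nabla \<phi> y - expected_gradient nabla (P t \<omega>) y))\<^sup>2 \<le> 4 * G\<^sup>2"
      using AE_deviation_le[OF t y] by (auto elim: eventually_mono)
  qed
  hence bdd: "bdd_above (?I ` X)" by (rule bdd_aboveI2)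
  show up: "?I y \<le> gradient_variance X nabla (P t \<omega>)" if "y \<in> X" for y
    unfolding gradient_variance_def using that bdd by (rule cSUP_upper)
  show "gradient_variance X nabla (P t \<omega>) \<le> 4 * G\<^sup>2"
    unfolding gradient_variance_def using domain(1) le by (rule cSUP_least)
  have "0 \<le> ?I x1" by simp
  also note up[OF start]
  finally show "0 \<le> gradient_variance X nabla (P t \<omega>)" .
qed
lemma AE_sample:
  assumes t: "t \<in> {1..T}" and Q: "Measurable.pred (H t \<Otimes>\<^sub>M N) Q"
    and "\<And>\<omega>. \<omega> \<in> space M \<Longrightarrow> AE \<phi> in P t \<omega>. Q (\<omega>, \<phi>)"
  shows "AE \<omega> in M. Q (\<omega>, f t \<omega>)"
  by (rule AE_conditional_law[OF history distribution[OF t] sample_M[OF t] conditional_law[OF t] Q assms(3)])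

lemma
  fixes h :: "'w \<times> (real ^ 'n \<Rightarrow> real) \<Rightarrow> real"
  assumes t: "t \<in> {1..T}" and h: "h \<in> borel_measurable (H t \<Otimes>\<^sub>M N)"
    and AE: "\<And>\<omega>. \<omega> \<in> space M \<Longrightarrow> AE \<phi> in P t \<omega>. \<bar>h (\<omega>, \<phi>)\<bar> \<le> B"
  shows integrable_sample: "integrable M (\<lambda>\<omega>. h (\<omega>, f t \<omega>))"
    and integrable_expected_sample: "integrable M (\<lambda>\<omega>. \<integral>\<phi>. h (\<omega>, \<phi>) \<partial>P t \<omega>)"
    and integral_sample: "(\<integral>\<omega>. h (\<omega>, f t \<omega>) \<partial>M) = (\<integral>\<omega>. (\<integral>\<phi>. h (\<omega>, \<phi>) \<partial>P t \<omega>) \<partial>M)"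
  by (rule integrable_conditional_law integrable_kernel_integral integral_conditional_law,
      (rule history distribution[OF t] sample_M[OF t] conditional_law[OF t] h AE | assumption)+)+

text \<open>
  The bound cannot be transferred from \<open>P t \<omega>\<close> to \<open>f t \<omega>\<close> for all points of \<open>X\<close> at once: the set of
  functions with gradient bounded on all of \<open>X\<close> need not be measurable.
\<close>

lemma AE_norm_g_le:
  assumes t: "t \<in> {1..T}"
  shows "AE \<omega> in M. norm (g t \<omega>) \<le> G"
proof -
  have "AE \<omega> in M. (\<lambda>p. norm (nabla (snd p) (x t (fst p))) \<le> G) (\<omega>, f t \<omega>)"
  proof (rule AE_sample[OF t])
    note [measurable] = gradient_play_measurable[OF t]
    show "Measurable.pred (H t \<Otimes>\<^sub>M N) (\<lambda>p. norm (nabla (snd p) (x t (fst p))) \<le> G)" by measurable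
    show "AE \<phi> in P t \<omega>. norm (nabla (snd (\<omega>, \<phi>)) (x t (fst (\<omega>, \<phi>)))) \<le> G" if "\<omega> \<in> space M" for \<omega>
      using AE_gradient_bound[OF t that x_in] t that by simp
  qed
  thus ?thesis by simp
qed

section \<open>Noise and regret of a single round\<close>

lemma F_eq: "t \<in> {1..T} \<Longrightarrow> F t \<omega> y = expected_gradient nabla (P t \<omega>) y"
  by (simp add: round_gradient_def)

lemma variance_integrable: "t \<in> {1..T} \<Longrightarrow> integrable M (\<lambda>\<omega>. gradient_variance X nabla (P t \<omega>))"
  using measurable_variance[of t] gradient_variance_nonneg[of t] gradient_variance_le[of t]
  by (intro integrable_const_bound[where B="4 * G\<^sup>2"]) (auto intro!: AE_I2)

text \<open>Given the past, \<open>x t \<omega>\<close> is a fixed point of \<open>X\<close>, so the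
  expected squared deviation there is one of the quantities over which the variance takes its
  supremum. This would break down for a point depending on \<open>f t\<close>.\<close>

lemma noise:
  assumes t: "t \<in> {1..T}"
  shows "integrable M (\<lambda>\<omega>. (norm (g t \<omega> - F t \<omega> (x t \<omega>)))\<^sup>2)"
    and "(\<integral>\<omega>. (norm (g t \<omega> - F t \<omega> (x t \<omega>)))\<^sup>2 \<partial>M) \<le> (\<integral>\<omega>. gradient_variance X nabla (P t \<omega>) \<partial>M)"
proof -
  define h where "h p = (norm (nabla (snd p) (x t (fst p))
      - expected_gradient nabla (P t (fst p)) (x t (fst p))))\<^sup>2" for p
  have xin: "x t \<omega> \<in> X" if "\<omega> \<in> space M" for \<omega> using x_in[of t] t that by simp
  note [measurable] = gradient_play_measurable[OF t]
  have "(\<lambda>\<omega>. expected_gradient nabla (P t \<omega>) (x t \<omega>)) \<in> borel_measurable (H t)"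
    using borel_measurable_integral_kernel[OF gradient_play_measurable[OF t] distribution_subprob[OF t]]
    by (simp add: expected_gradient_def)
  from measurable_compose[OF measurable_fst this]
  have [measurable]: "(\<lambda>p. expected_gradient nabla (P t (fst p)) (x t (fst p))) \<in> borel_measurable (H t \<Otimes>\<^sub>M N)" .
  have h: "h \<in> borel_measurable (H t \<Otimes>\<^sub>M N)" unfolding h_def[abs_def] by measurable
  have bd: "AE \<phi> in P t \<omega>. \<bar>h (\<omega>, \<phi>)\<bar> \<le> 4 * G\<^sup>2" if "\<omega> \<in> space M" for \<omega>
    using AE_deviation_le[OF t that xin[OF that]] by (simp add: h_def)
  have hf: "h (\<omega>, f t \<omega>) = (norm (g t \<omega> - F t \<omega> (x t \<omega>)))\<^sup>2" for \<omega>
    by (simp add: h_def F_eq[OF t])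
  show "integrable M (\<lambda>\<omega>. (norm (g t \<omega> - F t \<omega> (x t \<omega>)))\<^sup>2)"
    using integrable_sample[OF t h bd] by (simp add: hf)
  have "(\<integral>\<omega>. (norm (g t \<omega> - F t \<omega> (x t \<omega>)))\<^sup>2 \<partial>M) = (\<integral>\<omega>. (\<integral>\<phi>. h (\<omega>, \<phi>) \<partial>P t \<omega>) \<partial>M)"
    using integral_sample[OF t h bd] by (simp add: hf)
  also have "\<dots> \<le> (\<integral>\<omega>. gradient_variance X nabla (P t \<omega>) \<partial>M)"
  proof (rule integral_mono)
    show "integrable M (\<lambda>\<omega>. \<integral>\<phi>. h (\<omega>, \<phi>) \<partial>P t \<omega>)"
      by (rule integrable_expected_sample[OF t h bd])
    show "integrable M (\<lambda>\<omega>. gradient_variance X nabla (P t \<omega>))"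
      by (rule variance_integrable[OF t])
    show "(\<integral>\<phi>. h (\<omega>, \<phi>) \<partial>P t \<omega>) \<le> gradient_variance X nabla (P t \<omega>)" if "\<omega> \<in> space M" for \<omega>
      using deviation_le_variance[OF t that xin[OF that]] by (simp add: h_def)
  qed
  finally show "(\<integral>\<omega>. (norm (g t \<omega> - F t \<omega> (x t \<omega>)))\<^sup>2 \<partial>M) \<le> (\<integral>\<omega>. gradient_variance X nabla (P t \<omega>) \<partial>M)" .
qed

text \<open>The model bounds gradients and not values. By the mean value inequality differences of
  values are bounded too, so the conditional law is applied to
  \<open>f t \<omega> (x t \<omega>) - f t \<omega> u\<close> as a whole.\<close>

lemma abs_value_diff_le:
  assumes \<phi>: "\<phi> \<in> space N" "\<forall>y\<in>X. norm (nabla \<phi> y) \<le> G" and yz: "y \<in> X" "z \<in> X"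
  shows "\<bar>\<phi> y - \<phi> z\<bar> \<le> G * D"
proof -
  have "norm (\<phi> y - \<phi> z) \<le> G * norm (y - z)"
  proof (rule differentiable_bound[OF domain(3) _ _ yz])
    show "(\<phi> has_derivative (\<lambda>h. nabla \<phi> a \<bullet> h)) (at a within X)" if "a \<in> X" for a
      using gradient[OF \<phi>(1) that] by (simp add: has_gradient_within_def)
    show "onorm (\<lambda>h. nabla \<phi> a \<bullet> h) \<le> G" if "a \<in> X" for a
    proof (rule onorm_le)
      fix h
      have "norm (nabla \<phi> a \<bullet> h) \<le> norm (nabla \<phi> a) * norm h" by (simp add: Cauchy_Schwarz_ineq2)
      also have "\<dots> \<le> G * norm h" using \<phi>(2) that by (intro mult_right_mono) auto
      finally show "norm (nabla \<phi> a \<bullet> h) \<le> G * norm h" .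
    qed
  qed
  also have "\<dots> \<le> G * D" using diameter[OF yz] G by (intro mult_left_mono) auto
  finally show ?thesis by simp
qed

text \<open>The inequality may fail for a single \<open>\<phi>\<close>. Integration turns both sides
  into statements about the convex expected function.\<close>

lemma expected_loss_linearization:
  assumes t: "t \<in> {1..T}" "\<omega> \<in> space M" and yu: "y \<in> X" "u \<in> X"
  shows "(\<integral>\<phi>. \<phi> y - \<phi> u \<partial>P t \<omega>) \<le> (\<integral>\<phi>. nabla \<phi> y \<bullet> (y - u) \<partial>P t \<omega>)"
proof -
  have "expected_function (P t \<omega>) y + expected_gradient nabla (P t \<omega>) y \<bullet> (u - y)
      \<le> expected_function (P t \<omega>) u"
    using convex_on_tangent_within[OF convex[OF t] domain(3) yu]
      differentiate_expectation[OF t yu(1)] unfolding has_gradient_within_def by blast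
  moreover have "(\<integral>\<phi>. \<phi> y - \<phi> u \<partial>P t \<omega>) = expected_function (P t \<omega>) y - expected_function (P t \<omega>) u"
    using integrable_value[OF t] yu by (simp add: expected_function_def)
  moreover have "(\<integral>\<phi>. nabla \<phi> y \<bullet> (y - u) \<partial>P t \<omega>) = expected_gradient nabla (P t \<omega>) y \<bullet> (y - u)"
    using gradient_integrable[OF t yu(1)] by (simp add: expected_gradient_def)
  ultimately show ?thesis by (simp add: inner_diff_right)
qed

text \<open>The conditional law is used in both directions: the loss difference is averaged,
  linearized by convexity, and then the expected gradient is traded back for the sampled one, which
  is what the algorithm sees and what its regret bound controls.\<close>

lemma round_regret:
  assumes t: "t \<in> {1..T}" and u: "u \<in> X"
  shows "integrable M (\<lambda>\<omega>. f t \<omega> (x t \<omega>) - f t \<omega> u)"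
    and "integrable M (\<lambda>\<omega>. g t \<omega> \<bullet> (x t \<omega> - u))"
    and "(\<integral>\<omega>. f t \<omega> (x t \<omega>) - f t \<omega> u \<partial>M) \<le> (\<integral>\<omega>. g t \<omega> \<bullet> (x t \<omega> - u) \<partial>M)"
proof -
  have xin: "x t \<omega> \<in> X" if "\<omega> \<in> space M" for \<omega> using x_in[of t] t that by simp
  define a where "a p = (snd p) (x t (fst p)) - (snd p) u" for p :: "'w \<times> (real ^ 'n \<Rightarrow> real)"
  define b where "b p = nabla (snd p) (x t (fst p)) \<bullet> (x t (fst p) - u)" for p :: "'w \<times> (real ^ 'n \<Rightarrow> real)"
  note [measurable] = gradient_play_measurable[OF t] value_play_measurable[OF t] x_measurable_pair[OF t]
    measurable_compose[OF measurable_snd value_at_measurable[OF u], of "H t"]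
  have a: "a \<in> borel_measurable (H t \<Otimes>\<^sub>M N)" unfolding a_def[abs_def] by measurable
  have b: "b \<in> borel_measurable (H t \<Otimes>\<^sub>M N)" unfolding b_def[abs_def] by measurable
  have abd: "AE \<phi> in P t \<omega>. \<bar>a (\<omega>, \<phi>)\<bar> \<le> G * D" if w: "\<omega> \<in> space M" for \<omega>
    using bounded_gradients[OF t w] AE_space
  proof eventually_elim
    case (elim \<phi>)
    then show ?case
      using abs_value_diff_le[of \<phi>, OF _ _ xin[OF w] u] by (simp add: a_def space_P[OF t w])
  qed
  have bbd: "AE \<phi> in P t \<omega>. \<bar>b (\<omega>, \<phi>)\<bar> \<le> G * D" if w: "\<omega> \<in> space M" for \<omega>
    using AE_gradient_bound[OF t w xin[OF w]]
  proof eventually_elim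
    case (elim \<phi>)
    have "\<bar>nabla \<phi> (x t \<omega>) \<bullet> (x t \<omega> - u)\<bar> \<le> norm (nabla \<phi> (x t \<omega>)) * norm (x t \<omega> - u)"
      by (rule Cauchy_Schwarz_ineq2)
    also have "\<dots> \<le> G * D" using elim diameter[OF xin[OF w] u] G by (intro mult_mono) auto
    finally show ?case by (simp add: b_def)
  qed
  show "integrable M (\<lambda>\<omega>. f t \<omega> (x t \<omega>) - f t \<omega> u)"
    using integrable_sample[OF t a abd] by (simp add: a_def)
  show "integrable M (\<lambda>\<omega>. g t \<omega> \<bullet> (x t \<omega> - u))"
    using integrable_sample[OF t b bbd] by (simp add: b_def)
  have "(\<integral>\<omega>. f t \<omega> (x t \<omega>) - f t \<omega> u \<partial>M) = (\<integral>\<omega>. (\<integral>\<phi>. a (\<omega>, \<phi>) \<partial>P t \<omega>) \<partial>M)"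
    using integral_sample[OF t a abd] by (simp add: a_def)
  also have "\<dots> \<le> (\<integral>\<omega>. (\<integral>\<phi>. b (\<omega>, \<phi>) \<partial>P t \<omega>) \<partial>M)"
  proof (rule integral_mono)
    show "(\<integral>\<phi>. a (\<omega>, \<phi>) \<partial>P t \<omega>) \<le> (\<integral>\<phi>. b (\<omega>, \<phi>) \<partial>P t \<omega>)" if "\<omega> \<in> space M" for \<omega>
      using expected_loss_linearization[OF t that xin[OF that] u] by (simp add: a_def b_def)
  qed (rule integrable_expected_sample[OF t a abd] integrable_expected_sample[OF t b bbd]; assumption)+
  also have "\<dots> = (\<integral>\<omega>. g t \<omega> \<bullet> (x t \<omega> - u) \<partial>M)"
    using integral_sample[OF t b bbd] by (simp add: b_def)
  finally show "(\<integral>\<omega>. f t \<omega> (x t \<omega>) - f t \<omega> u \<partial>M) \<le> (\<integral>\<omega>. g t \<omega> \<bullet> (x t \<omega> - u) \<partial>M)" .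
qed

section \<open>Variation of the expected gradients and the final bound\<close>

abbreviation variation :: "nat \<Rightarrow> 'w \<Rightarrow> real" where
  "variation t \<omega> \<equiv> (SUP y\<in>X. (norm (F t \<omega> y - F (t - 1) \<omega> y))\<^sup>2)"

lemma F_lipschitz:
  "t \<le> T \<Longrightarrow> \<omega> \<in> space M \<Longrightarrow> y \<in> X \<Longrightarrow> z \<in> X \<Longrightarrow> norm (F t \<omega> y - F t \<omega> z) \<le> L * norm (y - z)"
  using smooth[of t \<omega> y z] L by (cases "t = 0") (auto simp: round_gradient_def)

lemma norm_F_le: "t \<le> T \<Longrightarrow> \<omega> \<in> space M \<Longrightarrow> y \<in> X \<Longrightarrow> norm (F t \<omega> y) \<le> G"
  using norm_expected_gradient_le[of t \<omega> y] G by (cases "t = 0") (auto simp: round_gradient_def)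

lemma F_measurable: "t \<le> T \<Longrightarrow> y \<in> X \<Longrightarrow> (\<lambda>\<omega>. F t \<omega> y) \<in> borel_measurable M"
  using measurable_H_M[OF measurable_compose[OF distribution_subprob[of t]
      integral_measurable_subprob_algebra[OF gradient_at_measurable[of y]]]]
  by (cases "t = 0") (auto simp: round_gradient_def expected_gradient_def)

lemma F_diff_sq_le:
  assumes "t \<in> {1..T}" "\<omega> \<in> space M" "y \<in> X"
  shows "(norm (F t \<omega> y - F (t - 1) \<omega> y))\<^sup>2 \<le> 4 * G\<^sup>2"
proof -
  have "norm (F t \<omega> y - F (t - 1) \<omega> y) \<le> 2 * G"
    using norm_triangle_ineq4[of "F t \<omega> y" "F (t - 1) \<omega> y"] norm_F_le[of t \<omega> y]
      norm_F_le[of "t - 1" \<omega> y] assms unfolding atLeastAtMost_iff by linarith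
  hence "(norm (F t \<omega> y - F (t - 1) \<omega> y))\<^sup>2 \<le> (2 * G)\<^sup>2" by (intro power_mono) auto
  thus ?thesis by simp
qed

text \<open>In contrast to the variance, the variation has a provable measurability: smoothness
  makes the gradient fields continuous, so the supremum over \<open>X\<close> equals the supremum
  over a countable dense subset \<open>C\<close>.\<close>

lemma
  assumes t: "t \<in> {1..T}"
  shows F_diff_le_variation: "\<omega> \<in> space M \<Longrightarrow> y \<in> X \<Longrightarrow>
      (norm (F t \<omega> y - F (t - 1) \<omega> y))\<^sup>2 \<le> variation t \<omega>"
    and variation_nonneg: "\<omega> \<in> space M \<Longrightarrow> 0 \<le> variation t \<omega>"
    and variation_integrable: "integrable M (variation t)"
proof -
  let ?d = "\<lambda>\<omega> y. (norm (F t \<omega> y - F (t - 1) \<omega> y))\<^sup>2"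
  have bdd: "bdd_above (?d \<omega> ` Y)" if "\<omega> \<in> space M" "Y \<subseteq> X" for \<omega> Y
    using F_diff_sq_le[OF t that(1)] that(2) by (intro bdd_aboveI2[where M="4 * G\<^sup>2"]) auto
  show up: "?d \<omega> y \<le> variation t \<omega>" if "\<omega> \<in> space M" "y \<in> X" for \<omega> y
    using that(2) bdd[OF that(1) order_refl] by (rule cSUP_upper)
  show nonneg: "0 \<le> variation t \<omega>" if "\<omega> \<in> space M" for \<omega>
    using order_trans[OF zero_le_power2 up[OF that start]] .
  have le: "variation t \<omega> \<le> 4 * G\<^sup>2" if "\<omega> \<in> space M" for \<omega>
    using domain(1) F_diff_sq_le[OF t that] by (rule cSUP_least)
  obtain C where C: "countable C" "C \<subseteq> X" "X \<subseteq> closure C" by (rule separable)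
  have clC: "closure C = X" using C domain(2) by (simp add: closure_minimal subset_antisym)
  have C0: "C \<noteq> {}" using clC domain(1) by auto
  have "variation t \<omega> = (SUP y\<in>C. ?d \<omega> y)" if w: "\<omega> \<in> space M" for \<omega>
  proof (rule antisym)
    have cont: "continuous_on X (F s \<omega>)" if "s \<le> T" for s
      using F_lipschitz[OF that w] L
      by (intro lipschitz_on_continuous_on[of L]) (auto simp: lipschitz_on_def dist_norm)
    have c: "continuous_on (closure C) (?d \<omega>)"
      unfolding clC using t by (intro continuous_intros cont) auto
    show "variation t \<omega> \<le> (SUP y\<in>C. ?d \<omega> y)"
    proof (rule cSUP_least[OF domain(1)])
      fix y assume "y \<in> X"
      hence "y \<in> closure C" using clC by simp
      thus "?d \<omega> y \<le> (SUP y\<in>C. ?d \<omega> y)"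
        by (rule continuous_le_on_closure[OF c]) (rule cSUP_upper[OF _ bdd[OF w C(2)]])
    qed
    show "(SUP y\<in>C. ?d \<omega> y) \<le> variation t \<omega>"
      using C0 bdd[OF w order_refl] C(2) by (intro cSUP_subset_mono) auto
  qed
  moreover have "(\<lambda>\<omega>. SUP y\<in>C. ?d \<omega> y) \<in> borel_measurable M"
  proof (rule borel_measurable_cSUP[OF C(1)])
    show "(\<lambda>\<omega>. ?d \<omega> y) \<in> borel_measurable M" if "y \<in> C" for y
      using F_measurable[of t y] F_measurable[of "t - 1" y] that C(2) t by (auto intro!: borel_measurable_power borel_measurable_norm borel_measurable_diff)
  qed (rule bdd[OF _ C(2)])
  ultimately have "variation t \<in> borel_measurable M" by (simp cong: measurable_cong)
  thus "integrable M (variation t)"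
    using nonneg le by (intro integrable_const_bound[where B="4 * G\<^sup>2"]) (auto intro!: AE_I2)
qed

text \<open>Variation and noise enter differently. The variation dominates the gradient change at
  the iterates for every outcome, while the noise \<open>A\<close> is comparable with the variance
  only in expectation, so it stays evaluated at the iterates until the square root has been moved
  outside the expectation.\<close>

lemma expected_regret:
  assumes u: "u \<in> X"
  shows "integrable M (\<lambda>\<omega>. (\<Sum>t=1..T. f t \<omega> (x t \<omega>)) - (\<Sum>t=1..T. f t \<omega> u))"
    and "0 \<le> cumulative_variance M X nabla P T" and "0 \<le> cumulative_variation M X nabla P T"
    and "(\<integral>\<omega>. (\<Sum>t=1..T. f t \<omega> (x t \<omega>)) - (\<Sum>t=1..T. f t \<omega> u) \<partial>M)
         \<le> 5 * sqrt 10 * D\<^sup>2 * L + 5 * sqrt 5 * D * G / 2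
           + 5 * sqrt 2 * D * sqrt (cumulative_variance M X nabla P T)
           + 5 * D * sqrt (cumulative_variation M X nabla P T)"
proof -
  define A where "A \<omega> = (\<Sum>t=1..T. (norm (g t \<omega> - F t \<omega> (x t \<omega>)))\<^sup>2)" for \<omega>
  define B where "B \<omega> = (\<Sum>t=1..T. variation t \<omega>)" for \<omega>
  define c where "c = 5 * sqrt 10 * D\<^sup>2 * L + 5 * sqrt 5 * D * G / 2"
  have A: "integrable M A" "expectation A \<le> cumulative_variance M X nabla P T"
  proof -
    show "integrable M A" unfolding A_def using noise(1) by (intro Bochner_Integration.integrable_sum)
    have "expectation A = (\<Sum>t=1..T. \<integral>\<omega>. (norm (g t \<omega> - F t \<omega> (x t \<omega>)))\<^sup>2 \<partial>M)"
      unfolding A_def using noise(1) by (intro Bochner_Integration.integral_sum)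
    also have "\<dots> \<le> (\<Sum>t=1..T. \<integral>\<omega>. gradient_variance X nabla (P t \<omega>) \<partial>M)"
      using noise(2) by (intro sum_mono)
    also have "\<dots> = cumulative_variance M X nabla P T"
      unfolding cumulative_variance_def using variance_integrable
      by (intro Bochner_Integration.integral_sum[symmetric])
    finally show "expectation A \<le> cumulative_variance M X nabla P T" .
  qed
  have B: "integrable M B" "expectation B = cumulative_variation M X nabla P T"
    unfolding B_def cumulative_variation_def
    using variation_integrable by (auto intro: Bochner_Integration.integrable_sum)
  have A0: "0 \<le> A \<omega>" for \<omega> by (simp add: A_def sum_nonneg)
  have B0: "0 \<le> B \<omega>" if "\<omega> \<in> space M" for \<omega>
    using variation_nonneg that unfolding B_def by (intro sum_nonneg)
  show "0 \<le> cumulative_variance M X nabla P T"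
    using A(2) integral_nonneg_AE[of A M] A0 by (auto intro: order_trans[rotated])
  show "0 \<le> cumulative_variation M X nabla P T"
    unfolding B(2)[symmetric] using B0 by (intro integral_nonneg_AE AE_I2)
  have diff: "(\<Sum>t=1..T. f t \<omega> (x t \<omega>)) - (\<Sum>t=1..T. f t \<omega> u)
      = (\<Sum>t=1..T. f t \<omega> (x t \<omega>) - f t \<omega> u)" for \<omega> by (simp add: sum_subtractf)
  show "integrable M (\<lambda>\<omega>. (\<Sum>t=1..T. f t \<omega> (x t \<omega>)) - (\<Sum>t=1..T. f t \<omega> u))"
    unfolding diff using round_regret(1)[OF _ u] by (intro Bochner_Integration.integrable_sum)
  have sqA: "integrable M (\<lambda>\<omega>. sqrt (A \<omega>))" "expectation (\<lambda>\<omega>. sqrt (A \<omega>)) \<le> sqrt (expectation A)"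
    using expectation_sqrt_le[OF A(1) A0] by auto
  have sqB: "integrable M (\<lambda>\<omega>. sqrt (B \<omega>))" "expectation (\<lambda>\<omega>. sqrt (B \<omega>)) \<le> sqrt (expectation B)"
    using expectation_sqrt_le[OF B(1) B0] by auto
  have pathwise: "AE \<omega> in M. (\<Sum>t=1..T. g t \<omega> \<bullet> (x t \<omega> - u))
      \<le> c + 5 * sqrt 2 * D * sqrt (A \<omega>) + 5 * D * sqrt (B \<omega>)"
  proof -
    have "AE \<omega> in M. \<forall>t\<in>{1..T}. norm (g t \<omega>) \<le> G"
      using AE_norm_g_le by (intro AE_finite_allI) auto
    then show ?thesis using AE_space
    proof eventually_elim
      case (elim \<omega>)
      have "(\<Sum>t=1..T. g t \<omega> \<bullet> (x t \<omega> - u))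
          \<le> 5 * sqrt 10 * D\<^sup>2 * L + 5 * sqrt 5 * D * G / 2
            + 5 * sqrt 2 * D * sqrt (\<Sum>t=1..T. (norm (g t \<omega> - F t \<omega> (x t \<omega>)))\<^sup>2)
            + 5 * D * sqrt (\<Sum>t=1..T. (norm (F t \<omega> (x t \<omega>) - F (t - 1) \<omega> (x t \<omega>)))\<^sup>2)"
        using elim F_lipschitz horizon D G L diameter
        by (intro optimistic_omd_regret_smooth[OF algorithm[OF elim(2)] domain(3,2) start u]) auto
      also have "(\<Sum>t=1..T. (norm (F t \<omega> (x t \<omega>) - F (t - 1) \<omega> (x t \<omega>)))\<^sup>2) \<le> B \<omega>"
        unfolding B_def using elim x_in by (intro sum_mono F_diff_le_variation) auto
      finally show ?case using D by (simp add: c_def A_def)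
    qed
  qed
  have "(\<integral>\<omega>. (\<Sum>t=1..T. f t \<omega> (x t \<omega>)) - (\<Sum>t=1..T. f t \<omega> u) \<partial>M)
      = (\<Sum>t=1..T. \<integral>\<omega>. f t \<omega> (x t \<omega>) - f t \<omega> u \<partial>M)"
    unfolding diff using round_regret(1)[OF _ u] by (intro Bochner_Integration.integral_sum)
  also have "\<dots> \<le> (\<Sum>t=1..T. \<integral>\<omega>. g t \<omega> \<bullet> (x t \<omega> - u) \<partial>M)"
    using round_regret(3)[OF _ u] by (intro sum_mono)
  also have "\<dots> = (\<integral>\<omega>. (\<Sum>t=1..T. g t \<omega> \<bullet> (x t \<omega> - u)) \<partial>M)"
    using round_regret(2)[OF _ u] by (intro Bochner_Integration.integral_sum[symmetric])
  also have "\<dots> \<le> (\<integral>\<omega>. c + 5 * sqrt 2 * D * sqrt (A \<omega>) + 5 * D * sqrt (B \<omega>) \<partial>M)"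
    using pathwise round_regret(2)[OF _ u] sqA(1) sqB(1)
    by (intro integral_mono_AE Bochner_Integration.integrable_sum) auto
  also have "\<dots> = c + 5 * sqrt 2 * D * expectation (\<lambda>\<omega>. sqrt (A \<omega>)) + 5 * D * expectation (\<lambda>\<omega>. sqrt (B \<omega>))"
    using sqA(1) sqB(1) by (simp add: prob_space)
  also have "\<dots> \<le> c + 5 * sqrt 2 * D * sqrt (cumulative_variance M X nabla P T)
      + 5 * D * sqrt (cumulative_variation M X nabla P T)"
    using sqA(2) sqB(2) A(2) D unfolding B(2)
    by (intro add_mono mult_left_mono order_refl order_trans[OF sqA(2)]) auto
  finally show "(\<integral>\<omega>. (\<Sum>t=1..T. f t \<omega> (x t \<omega>)) - (\<Sum>t=1..T. f t \<omega> u) \<partial>M)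
         \<le> 5 * sqrt 10 * D\<^sup>2 * L + 5 * sqrt 5 * D * G / 2
           + 5 * sqrt 2 * D * sqrt (cumulative_variance M X nabla P T)
           + 5 * D * sqrt (cumulative_variation M X nabla P T)"
    by (simp add: c_def)
qed

end

text \<open>The constant adds up the first three coefficients; the last one, \<open>5 * D\<close>,
  is dominated by \<open>5 * sqrt 2 * D\<close>.\<close>

lemma regret_bound_le_constant:
  fixes D G L s v :: real
  assumes "0 \<le> D" "0 \<le> G" "0 \<le> L" "0 \<le> s" "0 \<le> v"
  shows "5 * sqrt 10 * D\<^sup>2 * L + 5 * sqrt 5 * D * G / 2 + 5 * sqrt 2 * D * s + 5 * D * v
    \<le> regret_constant D G L * (1 + s + v)"
proof -
  define a where "a = 5 * sqrt 10 * D\<^sup>2 * L + 5 * sqrt 5 * D * G / 2"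
  define b where "b = 5 * sqrt 2 * D"
  have a: "0 \<le> a" unfolding a_def using assms by simp
  have "D * 1 \<le> D * sqrt 2" using assms by (intro mult_left_mono) auto
  hence b: "5 * D \<le> b" "0 \<le> b" unfolding b_def using assms by (auto simp: mult.commute)
  have "5 * D * v \<le> b * v" using b assms by (intro mult_right_mono)
  moreover have "0 \<le> a * (s + v)" "0 \<le> b * 1" using a b assms by auto
  ultimately have "a + b * s + 5 * D * v \<le> (a + b) * (1 + s + v)" by (simp add: algebra_simps)
  thus ?thesis by (simp add: regret_constant_def a_def b_def)
qed

theorem theorem1:
  fixes M :: "'w measure" and H :: "nat \<Rightarrow> 'w measure"
    and N :: "(real ^ 'n \<Rightarrow> real) measure"
    and X :: "(real ^ 'n) set"
    and nabla :: "(real ^ 'n \<Rightarrow> real) \<Rightarrow> real ^ 'n \<Rightarrow> real ^ 'n"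
    and P :: "nat \<Rightarrow> 'w \<Rightarrow> (real ^ 'n \<Rightarrow> real) measure"
    and f :: "nat \<Rightarrow> 'w \<Rightarrow> real ^ 'n \<Rightarrow> real"
    and x xhat :: "nat \<Rightarrow> 'w \<Rightarrow> real ^ 'n"
    and x1 u :: "real ^ 'n"
    and T :: nat and D G L :: real
  assumes "sea_model M H N X nabla P f T"
    and "G > 0" and "D > 0" and "L > 0"
    and bounded_gradients:
      "\<And>t \<omega>. t \<in> {1..T} \<Longrightarrow> \<omega> \<in> space M \<Longrightarrow> AE \<phi> in P t \<omega>. \<forall>y\<in>X. norm (nabla \<phi> y) \<le> G"
    and zero: "0 \<in> X"
    and diameter: "\<And>y z. y \<in> X \<Longrightarrow> z \<in> X \<Longrightarrow> norm (y - z) \<le> D"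
    and smooth:
      "\<And>t \<omega> y z. t \<in> {1..T} \<Longrightarrow> \<omega> \<in> space M \<Longrightarrow> y \<in> X \<Longrightarrow> z \<in> X \<Longrightarrow>
         norm (expected_gradient nabla (P t \<omega>) y - expected_gradient nabla (P t \<omega>) z)
           \<le> L * norm (y - z)"
    and convex:
      "\<And>t \<omega>. t \<in> {1..T} \<Longrightarrow> \<omega> \<in> space M \<Longrightarrow> convex_on X (expected_function (P t \<omega>))"
    and start: "x1 \<in> X"
    and algorithm:
      "\<And>\<omega>. \<omega> \<in> space M \<Longrightarrow>
         optimistic_omd X
           (adaptive_step D G (10 * D\<^sup>2 * L\<^sup>2)
              (observed_gradient (\<lambda>t. nabla (f t \<omega>)) (\<lambda>t. x t \<omega>)))
           T x1 (\<lambda>t. nabla (f t \<omega>)) (\<lambda>t. x t \<omega>) (\<lambda>t. xhat t \<omega>)"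
    and comparator: "u \<in> X"
  shows "integrable M (\<lambda>\<omega>. (\<Sum>t=1..T. f t \<omega> (x t \<omega>)) - (\<Sum>t=1..T. f t \<omega> u))
    \<and> (\<integral>\<omega>. (\<Sum>t=1..T. f t \<omega> (x t \<omega>)) - (\<Sum>t=1..T. f t \<omega> u) \<partial>M)
         \<le> 5 * sqrt 10 * D\<^sup>2 * L + 5 * sqrt 5 * D * G / 2
           + 5 * sqrt 2 * D * sqrt (cumulative_variance M X nabla P T)
           + 5 * D * sqrt (cumulative_variation M X nabla P T)
    \<and> (\<integral>\<omega>. (\<Sum>t=1..T. f t \<omega> (x t \<omega>)) - (\<Sum>t=1..T. f t \<omega> u) \<partial>M)
         \<le> regret_constant D G L
           * (1 + sqrt (cumulative_variance M X nabla P T)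
                + sqrt (cumulative_variation M X nabla P T))"
proof -
  interpret sea_omd M H N X nabla P f T x xhat x1 D G L
    by (intro sea_omd.intro sea_omd_axioms.intro assms)
  note R = expected_regret[OF comparator]
  have "5 * sqrt 10 * D\<^sup>2 * L + 5 * sqrt 5 * D * G / 2
        + 5 * sqrt 2 * D * sqrt (cumulative_variance M X nabla P T)
        + 5 * D * sqrt (cumulative_variation M X nabla P T)
      \<le> regret_constant D G L * (1 + sqrt (cumulative_variance M X nabla P T)
                + sqrt (cumulative_variation M X nabla P T))"
    using D G L R(2,3) by (intro regret_bound_le_constant) auto
  with R(1,4) show ?thesis by (intro conjI) (assumption | rule order_trans)+
qed

end
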